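(* Let $\ell\ge 1$ and let $N_1,\dots,N_\ell$ be positive integers. For every $\vec r_\ell=(r_1,\dots,r_\ell)\in\{0,1\}^\ell$, the $\ell$-layer NUDD scheme with sequence order set $\{N_1,\dots,N_\ell\}$ eliminates $\vec r_\ell$-type errors to order $\check N_{\vec r_\ell}$, where $$\check N_{\vec r_\ell}=\max_{i\in\{1,\dots,\ell\}}\Big[r_i\,\big(p_\oplus(1,i-1)\oplus 1\big)\,\widetilde N_i+p_+(i+1,\ell)\Big].$$ That is, all $n$-th order $\vec r_\ell$-type error coefficients vanish for $n\le \check N_{\vec r_\ell}$: $$F^{(n)}_{\vec r_\ell}=0\qquad\text{for all } n\le \check N_{\vec r_\ell}.$$ Explicitly, for every integer $1\le n\le\check N_{\vec r_\ell}$ and every choice of $\vec r_\ell^{\,(1)},\dots,\vec r_\ell^{\,(n)}\in\{0,1\}^\ell$ with $\oplus_{p=1}^n\vec r_\ell^{\,(p)}=\vec r_\ell$, one has $$\int_0^{1}d\eta^{(n)}\int_0^{\eta^{(n)}}d\eta^{(n-1)}\cdots\int_0^{\eta^{(2)}}d\eta^{(1)}\ \prod_{p=1}^n\prod_{i=1}^{\ell}f_i(\eta^{(p)})^{r_i^{(p)}}=0 .$$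
   Context: **Parity notation.** $[x]_2\in\{0,1\}$ is $x$ mod $2$; $\oplus$ is addition mod $2$ (componentwise on vectors in $\{0,1\}^\ell$). For a given $\vec r_\ell=(r_1,\dots,r_\ell)\in\{0,1\}^\ell$, $$p_\oplus(a,b)=\bigoplus_{k=a}^b r_k[N_k]_2,\qquad p_+(a,b)=\sum_{k=a}^b r_k[N_k]_2\quad(\text{ordinary integer sum}),$$ if $b\ge a$, and both are $0$ if $b<a$. In the formula for $\check N_{\vec r_\ell}$ the value $p_\oplus(1,i-1)\oplus1\in\{0,1\}$ is used as an integer. **Suppression orders.** Let $o_1$ be the smallest index $i$ with $N_i$ odd (if all $N_i$ are even, the condition $i\le o_1$ is regarded as true for all $i$). Then $$\widetilde N_i=\begin{cases}N_i & i\le o_1,\\ \min[N^{k'<i}_{o_{\min}}+1,\;N_i] & i>o_1,\end{cases}\qquad N^{k'<i}_{o_{\min}}=\min\{N_{k'} : k'<i,\ [N_{k'}]_2=1\}.$$ **NUDD timings (normalized to total time 1; layer 1 is innermost, layer $\ell$ outermost).** For each layer $k$ and $1\le j\le N_k+1$, let $$s^{(k)}_{j}=\sin\frac{\pi}{2(N_k+1)}\,\sin\frac{(2j-1)\pi}{2(N_k+1)}=\sin^2\frac{j\pi}{2(N_k+1)}-\sin^2\frac{(j-1)\pi}{2(N_k+1)}.$$ For $1\le i\le\ell$, $j_k\in\{1,\dots,N_k+1\}$ for $k>i$, and $j_i\in\{0,1,\dots,N_i+1\}$, the timings are $$\eta_{j_\ell,\dots,j_{i+1},j_i}=\eta_{j_\ell,\dots,j_{i+1},0}+s^{(\ell)}_{j_\ell}\cdots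 s^{(i+1)}_{j_{i+1}}\sin^2\frac{j_i\pi}{2(N_i+1)},$$ where $\eta_{j_\ell,\dots,j_{i+1},0}=\eta_{j_\ell,\dots,j_{i+2},\,j_{i+1}-1}$ for $i<\ell$, and $\eta_{j_\ell=0}=0$ (for $i=\ell$ the timing is $\eta_{j_\ell}=\sin^2\frac{j_\ell\pi}{2(N_\ell+1)}$). Thus each interval of the outer layers is recursively subdivided according to the Uhrig (UDD$_{N_i}$) timing of the next inner layer. **Modulation functions.** For $1\le i\le\ell$, $f_i:[0,1)\to\{\pm1\}$ is $$f_i(\eta)=(-1)^{j_i-1}\quad\text{for }\eta\in[\eta_{j_\ell,\dots,j_{i+1},j_i-1},\ \eta_{j_\ell,\dots,j_{i+1},j_i}),\qquad j_k\in\{1,\dots,N_k+1\}\ (k\ge i).$$ **NUDD coefficients.** For $\vec r_\ell^{\,(1)},\dots,\vec r_\ell^{\,(n)}\in\{0,1\}^\ell$ with $\oplus_{p=1}^n\vec r_\ell^{\,(p)}=\vec r_\ell$, where $\vec r_\ell^{\,(p)}=(r_1^{(p)},\dots,r_\ell^{(p)})$, the $n$-th order $\vec r_\ell$-type error coefficient is $$F^{(n)}_{\vec r_\ell}=F_{\oplus_{p=1}^n\vec r_\ell^{\,(p)}}=\int_0^{1}d\eta^{(n)}\int_0^{\eta^{(n)}}d\eta^{(n-1)}\cdots\int_0^{\eta^{(2)}}d\eta^{(1)}\prod_{p=1}^n\prod_{i=1}^{\ell}f_i(\eta^{(p)})^{r_i^{(p)}} .$$ The notation $F^{(n)}_{\vec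 r_\ell}$ refers to any such coefficient whose vectors sum mod 2 to $\vec r_\ell$; "$F^{(n)}_{\vec r_\ell}=0$" means all of them vanish. The scheme is said to eliminate $\vec r_\ell$-type errors to order $N$ if $F^{(n)}_{\vec r_\ell}=0$ for all $n\le N$ (for $N=0$ this asserts nothing). **Physical meaning.** The layers use control pulses $\Omega_1,\dots,\Omega_\ell$ that are independent, unitary, Hermitian, and mutually commuting or anticommuting. A bounded Hamiltonian decomposes as $H=\sum_{\vec r_\ell}H_{\vec r_\ell}$ with $\Omega_iH_{\vec r_\ell}\Omega_i=(-1)^{r_i}H_{\vec r_\ell}$. In the frame rotating with the pulses, the propagator over total time $T$ has Dyson expansion $\sum_{n\ge 0}(-iT)^n\sum_{\vec r_\ell^{\,(1)},\dots,\vec r_\ell^{\,(n)}}H_{\vec r_\ell^{\,(n)}}\cdots H_{\vec r_\ell^{\,(1)}}\,F_{\oplus_{p=1}^n\vec r_\ell^{\,(p)}}$; the coefficients $F$ depend only on the sequence orders. *)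

theory Defs
  imports "HOL-Analysis.Analysis"
begin

text \<open>
  Layers are numbered \<open>1..l\<close>, layer \<open>1\<close> being the innermost.  Sequence orders, bit vectors and
  tuples \<open>(j\<^sub>l, \<dots>, j\<^sub>i)\<close> are functions on \<open>nat\<close>; only the values at layers in \<open>{1..l}\<close>
  (resp. \<open>{i..l}\<close>) matter.
\<close>

definition parity_xor :: "(nat \<Rightarrow> nat) \<Rightarrow> (nat \<Rightarrow> nat) \<Rightarrow> nat \<Rightarrow> nat \<Rightarrow> nat" where
  "parity_xor N r a b = (\<Sum>k=a..b. r k * (N k mod 2)) mod 2"

definition parity_sum :: "(nat \<Rightarrow> nat) \<Rightarrow> (nat \<Rightarrow> nat) \<Rightarrow> nat \<Rightarrow> nat \<Rightarrow> nat" where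
  "parity_sum N r a b = (\<Sum>k=a..b. r k * (N k mod 2))"

definition first_odd :: "nat \<Rightarrow> (nat \<Rightarrow> nat) \<Rightarrow> nat" where
  "first_odd l N = (LEAST i. i \<in> {1..l} \<and> odd (N i))"

definition suppression_order :: "nat \<Rightarrow> (nat \<Rightarrow> nat) \<Rightarrow> nat \<Rightarrow> nat" where
  "suppression_order l N i =
     (if (\<forall>k\<in>{1..l}. even (N k)) \<or> i \<le> first_odd l N then N i
      else min (Min {N k | k. 1 \<le> k \<and> k < i \<and> odd (N k)} + 1) (N i))"

definition decoupling_order :: "nat \<Rightarrow> (nat \<Rightarrow> nat) \<Rightarrow> (nat \<Rightarrow> nat) \<Rightarrow> nat" where
  "decoupling_order l N r =
     Max ((\<lambda>i. r i * ((parity_xor N r 1 (i - 1) + 1) mod 2) * suppression_order l N i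
               + parity_sum N r (i + 1) l) ` {1..l})"


definition udd_interval :: "nat \<Rightarrow> nat \<Rightarrow> real" where
  "udd_interval M j =
     sin (pi / (2 * (real M + 1))) * sin ((2 * real j - 1) * pi / (2 * (real M + 1)))"

text \<open>
  \<open>nudd_time l N j i\<close> is the timing with index tuple \<open>(j l, \<dots>, j i)\<close>.  The first summand is the
  timing with last index \<open>0\<close>, i.e. the timing one layer further out with its last index decreased.
\<close>

function nudd_time :: "nat \<Rightarrow> (nat \<Rightarrow> nat) \<Rightarrow> (nat \<Rightarrow> nat) \<Rightarrow> nat \<Rightarrow> real" where
  "nudd_time l N j i =
     (if i < l then nudd_time l N (j(i + 1 := j (i + 1) - 1)) (i + 1) else 0)
     + (\<Prod>k=i+1..l. udd_interval (N k) (j k))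
       * (sin (real (j i) * pi / (2 * (real (N i) + 1))))\<^sup>2"
  by pat_completeness auto
termination by (relation "Wellfounded.measure (\<lambda>(l, N, j, i). l - i)") auto

declare nudd_time.simps [simp del]

definition nudd_indices :: "nat \<Rightarrow> (nat \<Rightarrow> nat) \<Rightarrow> nat \<Rightarrow> (nat \<Rightarrow> nat) set" where
  "nudd_indices l N i = {j. \<forall>k\<in>{i..l}. j k \<in> {1..N k + 1}}"

definition nudd_cell :: "nat \<Rightarrow> (nat \<Rightarrow> nat) \<Rightarrow> nat \<Rightarrow> (nat \<Rightarrow> nat) \<Rightarrow> real set" where
  "nudd_cell l N i j = {nudd_time l N (j(i := j i - 1)) i ..< nudd_time l N j i}"

text \<open>
  The cells of layer \<open>i\<close> partition \<open>[0, 1)\<close>, so the description below is proper there (see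
  \<open>nudd_cell_exists\<close> and \<open>modulation_eq\<close>); outside \<open>[0, 1)\<close> the value is irrelevant.
\<close>

definition modulation :: "nat \<Rightarrow> (nat \<Rightarrow> nat) \<Rightarrow> nat \<Rightarrow> real \<Rightarrow> real" where
  "modulation l N i t =
     (THE y. \<exists>j\<in>nudd_indices l N i. t \<in> nudd_cell l N i j \<and> y = (-1) ^ (j i - 1))"

text \<open>
  \<open>ordered_integral n \<Phi> x t\<close> is the iterated integral of \<open>\<Phi>\<close> over its first \<open>n\<close> coordinates, where
  coordinate \<open>n\<close> runs over \<open>[0, t]\<close> and each coordinate \<open>p < n\<close> over \<open>[0, x (p + 1)]\<close>.
\<close>

fun ordered_integral ::
    "nat \<Rightarrow> ((nat \<Rightarrow> real) \<Rightarrow> real) \<Rightarrow> (nat \<Rightarrow> real) \<Rightarrow> real \<Rightarrow> real" where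
  "ordered_integral 0 \<Phi> x t = \<Phi> x"
| "ordered_integral (Suc n) \<Phi> x t =
     integral {0..t} (\<lambda>u. ordered_integral n \<Phi> (x(Suc n := u)) u)"

definition nudd_coefficient ::
    "nat \<Rightarrow> (nat \<Rightarrow> nat) \<Rightarrow> nat \<Rightarrow> (nat \<Rightarrow> nat \<Rightarrow> nat) \<Rightarrow> real" where
  "nudd_coefficient l N n R =
     ordered_integral n (\<lambda>\<eta>. \<Prod>p=1..n. \<Prod>i=1..l. modulation l N i (\<eta> p) ^ R p i) (\<lambda>_. 0) 1"

definition eliminates_errors ::
    "nat \<Rightarrow> (nat \<Rightarrow> nat) \<Rightarrow> (nat \<Rightarrow> nat) \<Rightarrow> nat \<Rightarrow> bool" where
  "eliminates_errors l N r M \<longleftrightarrow>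
     (\<forall>n R. 1 \<le> n \<longrightarrow> n \<le> M \<longrightarrow>
        (\<forall>p\<in>{1..n}. R p \<in> {1..l} \<rightarrow> {0, 1}) \<longrightarrow>
        (\<forall>i\<in>{1..l}. (\<Sum>p=1..n. R p i) mod 2 = r i) \<longrightarrow>
        nudd_coefficient l N n R = 0)"


lemma nudd_time_cong:
  assumes "i \<le> l" "\<And>k. i \<le> k \<Longrightarrow> k \<le> l \<Longrightarrow> j k = j' k"
  shows "nudd_time l N j i = nudd_time l N j' i"
  using assms
proof (induction "l - i" arbitrary: i j j')
  case 0
  then show ?case by (simp add: nudd_time.simps[of _ _ _ i])
next
  case (Suc d)
  then have "i < l" by simp
  have "nudd_time l N (j(i + 1 := j (i + 1) - 1)) (i + 1)
      = nudd_time l N (j'(i + 1 := j' (i + 1) - 1)) (i + 1)"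
    by (rule Suc.hyps(1)) (use Suc.hyps(2) Suc.prems \<open>i < l\<close> in auto)
  moreover have "(\<Prod>k=i+1..l. udd_interval (N k) (j k)) = (\<Prod>k=i+1..l. udd_interval (N k) (j' k))"
    by (rule prod.cong) (use Suc.prems in auto)
  moreover have "j i = j' i" using Suc.prems by simp
  ultimately show ?case
    using \<open>i < l\<close> by (simp add: nudd_time.simps[of _ _ _ i])
qed

lemma udd_interval_eq:
  assumes "1 \<le> j"
  shows "udd_interval M j = (sin (real j * pi / (2 * (real M + 1))))\<^sup>2
           - (sin (real (j - 1) * pi / (2 * (real M + 1))))\<^sup>2"
proof -
  define c where "c = pi / (2 * (real M + 1))"
  have sq: "sin (a + b) * sin (a - b) = (sin a)\<^sup>2 - (sin b)\<^sup>2" for a b :: real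
  proof -
    have "sin (a + b) * sin (a - b) = (sin a)\<^sup>2 * (cos b)\<^sup>2 - (cos a)\<^sup>2 * (sin b)\<^sup>2"
      by (simp add: sin_add sin_diff power2_eq_square algebra_simps)
    also have "\<dots> = (sin a)\<^sup>2 - (sin b)\<^sup>2"
      by (simp add: cos_squared_eq algebra_simps)
    finally show ?thesis .
  qed
  have r: "real (j - 1) = real j - 1" using assms by simp
  have e: "real j * c + (real j - 1) * c = (2 * real j - 1) * c"
    "real j * c - (real j - 1) * c = c"
    by (simp_all add: algebra_simps)
  have "udd_interval M j = sin ((2 * real j - 1) * c) * sin c"
    by (simp add: udd_interval_def c_def mult.commute)
  also have "\<dots> = (sin (real j * c))\<^sup>2 - (sin ((real j - 1) * c))\<^sup>2"
    using sq[of "real j * c" "(real j - 1) * c"] unfolding e .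
  finally show ?thesis unfolding r by (simp add: c_def)
qed

lemma udd_interval_pos:
  assumes "j \<in> {1..M + 1}"
  shows "0 < udd_interval M j"
proof -
  have "0 < sin (pi / (2 * (real M + 1)))"
    by (rule sin_gt_zero) (auto simp: divide_simps)
  moreover have "0 < sin ((2 * real j - 1) * pi / (2 * (real M + 1)))"
  proof (rule sin_gt_zero)
    show "0 < (2 * real j - 1) * pi / (2 * (real M + 1))" using assms by simp
    have "(2 * real j - 1) < 2 * (real M + 1)" using assms by auto
    then show "(2 * real j - 1) * pi / (2 * (real M + 1)) < pi" by (simp add: divide_simps)
  qed
  ultimately show ?thesis by (simp add: udd_interval_def)
qed

lemma udd_grid_exists:
  assumes "0 \<le> x" "x < 1"
  shows "\<exists>m\<in>{1..M + 1}. (sin (real (m - 1) * pi / (2 * (real M + 1))))\<^sup>2 \<le> x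
           \<and> x < (sin (real m * pi / (2 * (real M + 1))))\<^sup>2"
proof -
  let ?g = "\<lambda>m::nat. (sin (real m * pi / (2 * (real M + 1))))\<^sup>2"
  define m where "m = (LEAST m. x < ?g m)"
  have "real (M + 1) * pi / (2 * (real M + 1)) = pi / 2" by (simp add: field_simps)
  then have top: "x < ?g (M + 1)" using assms by (simp only: sin_pi_half) simp
  then have "x < ?g m" "m \<le> M + 1"
    unfolding m_def by (rule LeastI, rule Least_le)
  moreover have "m \<noteq> 0"
    using \<open>x < ?g m\<close> assms by (intro notI) simp
  moreover have "?g (m - 1) \<le> x"
    using not_less_Least[of "m - 1" "\<lambda>m. x < ?g m"] \<open>m \<noteq> 0\<close> by (simp add: m_def)
  ultimately show ?thesis by (intro bexI[of _ m]) auto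
qed

lemma udd_grid_mono:
  assumes "m \<le> m'" "m' \<le> M + 1"
  shows "(sin (real m * pi / (2 * (real M + 1))))\<^sup>2 \<le> (sin (real m' * pi / (2 * (real M + 1))))\<^sup>2"
proof -
  have mono: "(sin x)\<^sup>2 \<le> (sin y)\<^sup>2" if "0 \<le> x" "x \<le> y" "y \<le> pi / 2" for x y :: real
  proof (rule power_mono)
    show "sin x \<le> sin y" using that by (intro sin_monotone_2pi_le) auto
    show "0 \<le> sin x" using that pi_gt_zero by (intro sin_ge_zero) linarith+
  qed
  show ?thesis
  proof (rule mono)
    show "real m * pi / (2 * (real M + 1)) \<le> real m' * pi / (2 * (real M + 1))"
      using assms by (intro divide_right_mono mult_right_mono) auto
    have "real m' \<le> real M + 1" using assms by linarith
    then show "real m' * pi / (2 * (real M + 1)) \<le> pi / 2" by (simp add: divide_simps)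
  qed simp
qed

lemma nudd_cell_eq:
  fixes N :: "nat \<Rightarrow> nat"
  assumes "i \<le> l"
  defines "a \<equiv> \<lambda>j. if i < l then nudd_time l N (j(i + 1 := j (i + 1) - 1)) (i + 1) else 0"
  defines "d \<equiv> \<lambda>j. \<Prod>k=i+1..l. udd_interval (N k) (j k)"
  shows "nudd_cell l N i j =
    {a j + d j * (sin (real (j i - 1) * pi / (2 * (real (N i) + 1))))\<^sup>2 ..<
     a j + d j * (sin (real (j i) * pi / (2 * (real (N i) + 1))))\<^sup>2}"
proof -
  have "a (j(i := j i - 1)) = a j"
    by (auto simp: a_def intro!: nudd_time_cong)
  moreover have "d (j(i := j i - 1)) = d j"
    by (auto simp: d_def intro!: prod.cong)
  ultimately show ?thesis
    unfolding nudd_cell_def nudd_time.simps[of _ _ _ i] a_def d_def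
    by (simp only: fun_upd_same)
qed

lemma nudd_time_upper:
  assumes "1 \<le> j i" "i \<le> l"
  shows "nudd_time l N j i = nudd_time l N (j(i := j i - 1)) i + (\<Prod>k=i..l. udd_interval (N k) (j k))"
proof -
  have "(if i < l then nudd_time l N ((j(i := j i - 1))(i + 1 := (j(i := j i - 1)) (i + 1) - 1)) (i + 1) else 0)
      = (if i < l then nudd_time l N (j(i + 1 := j (i + 1) - 1)) (i + 1) else 0)"
    by (auto intro!: nudd_time_cong)
  moreover have "(\<Prod>k=i+1..l. udd_interval (N k) ((j(i := j i - 1)) k))
      = (\<Prod>k=i+1..l. udd_interval (N k) (j k))"
    by (auto intro!: prod.cong)
  moreover have "(\<Prod>k=i..l. udd_interval (N k) (j k))
      = udd_interval (N i) (j i) * (\<Prod>k=i+1..l. udd_interval (N k) (j k))"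
    using assms by (simp add: prod.atLeast_Suc_atMost)
  ultimately show ?thesis
    unfolding nudd_time.simps[of _ _ _ i] udd_interval_eq[OF assms(1)]
    by (simp only: fun_upd_same) (simp add: algebra_simps)
qed

lemma nudd_cell_outer:
  fixes N :: "nat \<Rightarrow> nat"
  assumes "i < l" "j \<in> nudd_indices l N (i + 1)"
  defines "a \<equiv> nudd_time l N (j(i + 1 := j (i + 1) - 1)) (i + 1)"
  defines "d \<equiv> \<Prod>k=i+1..l. udd_interval (N k) (j k)"
  shows "nudd_cell l N (i + 1) j = {a ..< a + d}" "0 < d"
proof -
  have "1 \<le> j (i + 1)" using assms by (auto simp: nudd_indices_def)
  then show "nudd_cell l N (i + 1) j = {a ..< a + d}"
    using nudd_time_upper[of j "i + 1" l N] assms(1) by (simp add: nudd_cell_def a_def d_def)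
  show "0 < d" unfolding d_def
    by (rule prod_pos) (use assms(2) in \<open>auto simp: nudd_indices_def intro!: udd_interval_pos\<close>)
qed

theorem nudd_cell_exists:
  assumes "i \<le> l" "0 \<le> t" "t < 1"
  shows "\<exists>j\<in>nudd_indices l N i. t \<in> nudd_cell l N i j"
  using assms(1)
proof (induction i rule: inc_induct)
  case base
  obtain m where m: "m \<in> {1..N l + 1}"
    "(sin (real (m - 1) * pi / (2 * (real (N l) + 1))))\<^sup>2 \<le> t"
    "t < (sin (real m * pi / (2 * (real (N l) + 1))))\<^sup>2"
    using udd_grid_exists[OF assms(2,3)] by blast
  then show ?case
    by (intro bexI[of _ "\<lambda>_. m"]) (auto simp: nudd_cell_eq nudd_indices_def)
next
  case (step i)
  then obtain j where j: "j \<in> nudd_indices l N (i + 1)" "t \<in> nudd_cell l N (i + 1) j" by auto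
  define a where "a = nudd_time l N (j(i + 1 := j (i + 1) - 1)) (i + 1)"
  define d where "d = (\<Prod>k=i+1..l. udd_interval (N k) (j k))"
  have c: "t \<in> {a ..< a + d}" "0 < d"
    using nudd_cell_outer[OF step.hyps(2) j(1)] j(2) unfolding a_def d_def by auto
  then have "0 \<le> (t - a) / d" "(t - a) / d < 1" by (auto simp: divide_simps)
  from udd_grid_exists[OF this] obtain m where m: "m \<in> {1..N i + 1}"
    "(sin (real (m - 1) * pi / (2 * (real (N i) + 1))))\<^sup>2 \<le> (t - a) / d"
    "(t - a) / d < (sin (real m * pi / (2 * (real (N i) + 1))))\<^sup>2" by blast
  let ?j = "j(i := m)"
  have "nudd_time l N (?j(i + 1 := ?j (i + 1) - 1)) (i + 1) = a"
    unfolding a_def by (rule nudd_time_cong) (use step.hyps in auto)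
  moreover have "(\<Prod>k=i+1..l. udd_interval (N k) (?j k)) = d"
    unfolding d_def by (rule prod.cong) auto
  ultimately have "nudd_cell l N i ?j =
    {a + d * (sin (real (m - 1) * pi / (2 * (real (N i) + 1))))\<^sup>2 ..<
     a + d * (sin (real m * pi / (2 * (real (N i) + 1))))\<^sup>2}"
    using step.hyps by (subst nudd_cell_eq) (auto simp del: fun_upd_apply simp: fun_upd_same)
  then have "t \<in> nudd_cell l N i ?j"
    using m(2,3) c(2) by (simp add: divide_simps mult.commute)
  moreover have "?j \<in> nudd_indices l N i"
    using j(1) m(1) by (auto simp: nudd_indices_def)
  ultimately show ?case by blast
qed

lemma nudd_cell_unique:
  assumes "i \<le> l" "j \<in> nudd_indices l N i" "j' \<in> nudd_indices l N i"
    "t \<in> nudd_cell l N i j" "t \<in> nudd_cell l N i j'"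
  shows "\<forall>k\<in>{i..l}. j k = j' k"
  using assms
proof (induction i rule: inc_induct)
  case base
  let ?s = "\<lambda>m::nat. (sin (real m * pi / (2 * (real (N l) + 1))))\<^sup>2"
  have cell: "nudd_cell l N l j = {?s (j l - 1) ..< ?s (j l)}" for j
    by (subst nudd_cell_eq) auto
  have False if "j l < j' l" "j' \<in> nudd_indices l N l" "t \<in> nudd_cell l N l j"
    "t \<in> nudd_cell l N l j'" for j j'
  proof -
    have "?s (j l) \<le> ?s (j' l - 1)"
      using that(1,2) by (intro udd_grid_mono) (auto simp: nudd_indices_def)
    moreover have "t < ?s (j l)" "?s (j' l - 1) \<le> t"
      using that(3,4) unfolding cell atLeastLessThan_iff by blast+
    ultimately show False by linarith
  qed
  from this[of j j'] this[of j' j] base show ?case by (cases "j l" "j' l" rule: linorder_cases) auto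
next
  case (step i)
  let ?a = "\<lambda>j. nudd_time l N (j(i + 1 := j (i + 1) - 1)) (i + 1)"
  let ?d = "\<lambda>j. \<Prod>k=i+1..l. udd_interval (N k) (j k)"
  let ?s = "\<lambda>m::nat. (sin (real m * pi / (2 * (real (N i) + 1))))\<^sup>2"
  have cell: "nudd_cell l N i j = {?a j + ?d j * ?s (j i - 1) ..< ?a j + ?d j * ?s (j i)}" for j
    using step.hyps by (subst nudd_cell_eq) auto
  have sub: "j \<in> nudd_indices l N (i + 1)" "0 < ?d j" "t \<in> nudd_cell l N (i + 1) j"
    if "j \<in> nudd_indices l N i" "t \<in> nudd_cell l N i j" for j
  proof -
    show ind: "j \<in> nudd_indices l N (i + 1)" using that(1) by (auto simp: nudd_indices_def)
    note o = nudd_cell_outer[OF step.hyps(2) this]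
    show "0 < ?d j" by (rule o)
    have "?d j * ?s (j i - 1) \<ge> 0" using o(2) by simp
    moreover have "?d j * ?s (j i) \<le> ?d j * 1"
      using o(2) by (intro mult_left_mono) (auto simp: abs_square_le_1)
    ultimately show "t \<in> nudd_cell l N (i + 1) j"
      using that(2) unfolding o(1) cell by auto
  qed
  have eq: "\<forall>k\<in>{i+1..l}. j k = j' k"
    using step.IH sub step.prems by simp
  have a: "?a j = ?a j'" by (rule nudd_time_cong) (use step.hyps eq in auto)
  have d: "?d j = ?d j'" by (rule prod.cong) (use eq in auto)
  have F: False if "x < y" "y \<le> N i + 1" "t < ?a j + ?d j * ?s x" "?a j + ?d j * ?s (y - 1) \<le> t" for x y
  proof -
    have "?s x \<le> ?s (y - 1)" using that by (intro udd_grid_mono) auto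
    then have "?d j * ?s x \<le> ?d j * ?s (y - 1)"
      using sub(2)[of j] step.prems by (intro mult_left_mono) auto
    then show False using that by linarith
  qed
  have "j i = j' i"
  proof (cases "j i" "j' i" rule: linorder_cases)
    case less
    then show ?thesis
      using F[of "j i" "j' i"] step.prems(2-4) a d step.hyps unfolding cell
      by (auto simp: nudd_indices_def)
  next
    case greater
    then show ?thesis
      using F[of "j' i" "j i"] step.prems(1,3,4) a d step.hyps unfolding cell
      by (auto simp: nudd_indices_def)
  qed
  with eq show ?case by (auto simp: Suc_le_eq le_less)
qed

theorem modulation_eq:
  assumes "i \<le> l" "j \<in> nudd_indices l N i" "t \<in> nudd_cell l N i j"
  shows "modulation l N i t = (-1) ^ (j i - 1)"
  unfolding modulation_def
proof (rule the_equality)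
  fix y :: real
  assume "\<exists>j\<in>nudd_indices l N i. t \<in> nudd_cell l N i j \<and> y = (-1) ^ (j i - 1)"
  then obtain j' where "j' \<in> nudd_indices l N i" "t \<in> nudd_cell l N i j'" "y = (-1) ^ (j' i - 1)"
    by blast
  moreover have "j i = j' i"
    using nudd_cell_unique[OF assms(1,2) calculation(1) assms(3) calculation(2)] assms(1) by auto
  ultimately show "y = (-1) ^ (j i - 1)" by simp
qed (use assms in blast)

end

theory Submission
  imports Defs
begin

text \<open>
  By Chen's identity the error coefficients of the scheme form a series in noncommuting letters
  which is a product \<open>V\<^bsub>M+1\<^esub> \<cdots> V\<^sub>1\<close> over the outermost intervals, \<open>V\<^sub>j\<close> being the series of the inner
  scheme rescaled by \<open>s\<^sub>j\<close> with sign \<open>(-1)\<^bsup>j-1\<^esup>\<close> for the letters anticommuting with the outer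
  pulse; one inducts on the number of layers.  The claimed orders are subadditive in the error type,
  so an inner suppression order survives in the product, and at the first unsuppressed order the
  product is additive in the \<open>V\<^sub>j\<close>; for odd \<open>M\<close> the alternating sum over the symmetric \<open>s\<^sub>j\<close> vanishes,
  which gains one order.

  For the outer layer's own suppression, time-reversal symmetry makes the partial products
  \<open>V\<^sub>J \<cdots> V\<^sub>1\<close> even or odd under \<open>J \<mapsto> -J\<close>, and for words no longer than \<open>M\<close> they are combinations of waves
  \<open>cos ((q + p (M + 1)) \<pi> J / (M + 1) + \<phi>)\<close> with \<open>\<bar>q\<bar> \<le> M\<close>: summing over \<open>J\<close> meets no resonance except for
  a constant or a linear term, and parity excludes those.  An odd function of period \<open>2 (M + 1)\<close> vanishes
  at \<open>M + 1\<close>.  The words of odd inner weight have the wrong parity; they vanish below the least odd inner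
  order plus one, which is where \<open>suppression_order\<close> comes from.
\<close>

subsection \<open>Noncommutative series\<close>

definition conv :: "('a list \<Rightarrow> real) \<Rightarrow> ('a list \<Rightarrow> real) \<Rightarrow> 'a list \<Rightarrow> real"  (infixl "\<star>" 70)
  where "(X \<star> Y) w = (\<Sum>i\<le>length w. X (take i w) * Y (drop i w))"

definition unit_series :: "'a list \<Rightarrow> real"
  where "unit_series w = (if w = [] then 1 else 0)"

text \<open>The antipode of the shuffle Hopf algebra. For a series of iterated integrals it is the
  inverse under \<open>\<star>\<close>, the path being run backwards.\<close>

definition antipode :: "('a list \<Rightarrow> real) \<Rightarrow> 'a list \<Rightarrow> real"
  where "antipode X w = (-1) ^ length w * X (rev w)"

lemma conv_Nil [simp]: "(X \<star> Y) [] = X [] * Y []"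
  by (simp add: conv_def)

lemma conv_Cons: "(X \<star> Y) (a # w) = X [] * Y (a # w) + ((\<lambda>u. X (a # u)) \<star> Y) w"
  by (simp add: conv_def sum.atMost_Suc_shift del: sum.atMost_Suc)

text \<open>\<open>conv_Cons\<close> turns a product on the left into a combination
  \<open>c * X u + Y u\<close>; with this, associativity is an induction on the word in which the
  left factor varies.\<close>

lemma conv_linear_left:
  "((\<lambda>u. c * X u + Y u) \<star> Z) w = c * (X \<star> Z) w + (Y \<star> Z) w"
  by (simp add: conv_def sum_distrib_left sum.distrib algebra_simps)

lemma conv_assoc: "(X \<star> Y) \<star> Z = X \<star> (Y \<star> Z)"
proof
  fix w show "((X \<star> Y) \<star> Z) w = (X \<star> (Y \<star> Z)) w"
    by (induction w arbitrary: X) (simp_all add: conv_Cons conv_linear_left algebra_simps)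
qed

lemma conv_unit_left [simp]: "unit_series \<star> X = X"
proof
  fix w
  have "(\<Sum>i\<le>length w. unit_series (take i w) * X (drop i w)) = (\<Sum>i\<le>length w. if i = 0 then X w else 0)"
    by (rule sum.cong) (auto simp: unit_series_def)
  then show "(unit_series \<star> X) w = X w" by (simp add: conv_def)
qed

lemma conv_unit_right [simp]: "X \<star> unit_series = X"
proof
  fix w
  have "(\<Sum>i\<le>length w. X (take i w) * unit_series (drop i w)) = (\<Sum>i\<le>length w. if i = length w then X w else 0)"
    by (rule sum.cong) (auto simp: unit_series_def)
  then show "(X \<star> unit_series) w = X w" by (simp add: conv_def)
qed

lemma conv_twist:
  fixes c :: "'a list \<Rightarrow> real"
  assumes "\<And>u v. c (u @ v) = c u * c v"
  shows "(\<lambda>w. c w * X w) \<star> (\<lambda>w. c w * Y w) = (\<lambda>w. c w * (X \<star> Y) w)"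
proof
  fix w
  have "(\<Sum>i\<le>length w. (c (take i w) * X (take i w)) * (c (drop i w) * Y (drop i w)))
      = (\<Sum>i\<le>length w. c w * (X (take i w) * Y (drop i w)))"
  proof (rule sum.cong)
    fix i
    have "c w = c (take i w) * c (drop i w)" using assms[of "take i w" "drop i w"] by simp
    then show "(c (take i w) * X (take i w)) * (c (drop i w) * Y (drop i w)) = c w * (X (take i w) * Y (drop i w))"
      by simp
  qed simp
  then show "((\<lambda>w. c w * X w) \<star> (\<lambda>w. c w * Y w)) w = c w * (X \<star> Y) w"
    by (simp add: conv_def sum_distrib_left)
qed

lemma conv_rev: "(X \<star> Y) (rev w) = ((\<lambda>u. Y (rev u)) \<star> (\<lambda>u. X (rev u))) w"
proof -
  have "(\<Sum>i\<le>length w. X (take i (rev w)) * Y (drop i (rev w)))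
      = (\<Sum>i\<le>length w. Y (rev (take i w)) * X (rev (drop i w)))"
    by (rule sum.reindex_bij_witness[of _ "\<lambda>i. length w - i" "\<lambda>i. length w - i"])
       (auto simp: take_rev drop_rev)
  then show ?thesis by (simp add: conv_def)
qed

lemma antipode_conv: "antipode (X \<star> Y) = antipode Y \<star> antipode X"
proof
  fix w
  show "antipode (X \<star> Y) w = (antipode Y \<star> antipode X) w"
    using fun_cong[OF conv_twist[of "\<lambda>w. (-1) ^ length w" "\<lambda>u. Y (rev u)" "\<lambda>u. X (rev u)"], of w]
    by (simp add: antipode_def[abs_def] conv_rev power_add)
qed

lemma conv_antipode_unit:
  assumes "X \<star> antipode X = unit_series" "Y \<star> antipode Y = unit_series"
  shows "(X \<star> Y) \<star> antipode (X \<star> Y) = unit_series"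
  by (metis antipode_conv assms conv_assoc conv_unit_left)

lemma antipode_unit [simp]: "antipode unit_series = unit_series"
  by (auto simp: antipode_def unit_series_def)

definition vanishes_below :: "('a list \<Rightarrow> nat) \<Rightarrow> ('a list \<Rightarrow> real) \<Rightarrow> bool"
  where "vanishes_below K X \<longleftrightarrow> (\<forall>w. w \<noteq> [] \<longrightarrow> length w \<le> K w \<longrightarrow> X w = 0)"

text \<open>At a proper cut \<open>u @ v\<close> with nonzero contribution both pieces exceed their
  bounds, so the length is at least \<open>K u + K v + 2\<close>, hence at least
  \<open>K w + 2\<close>. Up to one order past \<open>K w\<close> only the two trivial cuts remain,
  and the product acts as a sum.\<close>

lemma conv_vanishing:
  assumes K: "\<And>u v. K (u @ v) \<le> K u + K v"
    and X: "vanishes_below K X" and Y: "vanishes_below K Y"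
    and w: "w \<noteq> []" "length w \<le> K w + 1"
  shows "(X \<star> Y) w = X w * Y [] + X [] * Y w"
proof -
  have z: "X (take i w) * Y (drop i w) = 0" if i: "i \<le> length w" "i \<noteq> 0" "i \<noteq> length w" for i
  proof (rule ccontr)
    assume "X (take i w) * Y (drop i w) \<noteq> 0"
    then have "\<not> length (take i w) \<le> K (take i w)" "\<not> length (drop i w) \<le> K (drop i w)"
      using X Y i w(1) unfolding vanishes_below_def by auto
    then have "K w + 2 \<le> length (take i w) + length (drop i w)"
      using K[of "take i w" "drop i w"] by simp
    then show False using w i by simp
  qed
  have "(X \<star> Y) w = (\<Sum>i\<in>{0, length w}. X (take i w) * Y (drop i w))"
    unfolding conv_def by (rule sum.mono_neutral_right) (use z in auto)
  then show ?thesis using w by simp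
qed

lemma vanishes_below_conv:
  assumes "\<And>u v. K (u @ v) \<le> K u + K v" "vanishes_below K X" "vanishes_below K Y"
  shows "vanishes_below K (X \<star> Y)"
  using conv_vanishing[OF assms] assms(2,3) by (auto simp: vanishes_below_def)

section \<open>Products over the intervals of one outer layer\<close>

definition alt_sign :: "int \<Rightarrow> real"
  where "alt_sign j = (if odd j then 1 else -1)"

text \<open>The formula of \<open>udd_interval\<close>, like (-1)^(j-1) in \<open>alt_sign\<close>,
  is taken at all integers, so that products can be continued to negative indices.\<close>

definition udd_length :: "nat \<Rightarrow> int \<Rightarrow> real"
  where "udd_length M j = sin (pi / (2 * (real M + 1))) * sin ((2 * of_int j - 1) * pi / (2 * (real M + 1)))"

text \<open>The inner scheme \<open>g\<close> run inside the \<open>j\<close>-th outer interval: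
  each letter picks up the interval length, and each letter counted by \<open>d\<close> the outer
  sign.\<close>

definition udd_factor :: "nat \<Rightarrow> ('a list \<Rightarrow> nat) \<Rightarrow> ('a list \<Rightarrow> real) \<Rightarrow> int \<Rightarrow> 'a list \<Rightarrow> real"
  where "udd_factor M d g j w = udd_length M j ^ length w * alt_sign j ^ d w * g w"

fun udd_product :: "nat \<Rightarrow> ('a list \<Rightarrow> nat) \<Rightarrow> ('a list \<Rightarrow> real) \<Rightarrow> nat \<Rightarrow> 'a list \<Rightarrow> real" where
  "udd_product M d g 0 = unit_series"
| "udd_product M d g (Suc j) = udd_factor M d g (int (Suc j)) \<star> udd_product M d g j"

lemma udd_length_reflect: "udd_length M (int M + 2 - j) = udd_length M j"
proof -
  have "(2 * of_int (int M + 2 - j) - 1) * pi / (2 * (real M + 1))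
      = pi - (2 * of_int j - 1) * pi / (2 * (real M + 1))"
    by (simp add: field_simps)
  then show ?thesis by (simp only: udd_length_def sin_pi_minus)
qed

lemma udd_length_neg: "udd_length M (- j) = - udd_length M (j + 1)"
proof -
  have "(2 * of_int (- j) - 1) * pi / (2 * (real M + 1))
      = - ((2 * of_int (j + 1) - 1) * pi / (2 * (real M + 1)))"
    by (simp add: field_simps)
  then show ?thesis by (simp only: udd_length_def sin_minus)
qed

lemma alt_sign_reflect: "alt_sign (int M + 2 - j) = (-1) ^ M * alt_sign j"
  by (cases "even M") (auto simp: alt_sign_def)

lemma alt_sign_neg: "alt_sign (- j) = - alt_sign (j + 1)"
  by (auto simp: alt_sign_def)

text \<open>\<open>d\<close> counts the letters anticommuting with the outer pulse, and
  \<open>(-1) ^ e w\<close> is the effect of time reversal on the inner series \<open>g\<close>,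
  whose inverse is its antipode as for iterated integrals.\<close>

locale udd_layer =
  fixes M :: nat and d e :: "'a list \<Rightarrow> nat" and g :: "'a list \<Rightarrow> real"
  assumes d_append: "d (u @ v) = d u + d v"
    and e_append: "e (u @ v) = e u + e v"
    and g_rev: "g (rev w) = (-1) ^ e w * g w"
    and g_antipode: "g \<star> antipode g = unit_series"
    and g_Nil: "g [] = 1"
begin

abbreviation "V \<equiv> udd_factor M d g"
abbreviation "X \<equiv> udd_product M d g"

lemma d_Nil [simp]: "d [] = 0" using d_append[of "[]" "[]"] by simp
lemma e_Nil [simp]: "e [] = 0" using e_append[of "[]" "[]"] by simp

lemma d_rev: "d (rev w) = d w"
proof (induction w)
  case (Cons a w)
  then show ?case using d_append[of "[a]" w] by (simp add: d_append)
qed simp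

lemma V_Nil [simp]: "V j [] = 1" by (simp add: udd_factor_def g_Nil)
lemma X_Nil [simp]: "X j [] = 1" by (induction j) (simp_all add: unit_series_def)

lemma V_antipode: "V j \<star> antipode (V j) = unit_series"
proof -
  let ?c = "\<lambda>w. udd_length M j ^ length w * alt_sign j ^ d w"
  have "V j \<star> antipode (V j) = (\<lambda>w. ?c w * g w) \<star> (\<lambda>w. ?c w * antipode g w)"
    by (rule arg_cong2[where f = conv]) (auto simp: udd_factor_def antipode_def d_rev)
  also have "\<dots> = (\<lambda>w. ?c w * unit_series w)"
    by (subst conv_twist) (auto simp: d_append power_add g_antipode)
  also have "\<dots> = unit_series" by (auto simp: unit_series_def)
  finally show ?thesis .
qed

lemma X_antipode: "X j \<star> antipode (X j) = unit_series"
  by (induction j) (simp_all add: conv_antipode_unit V_antipode del: of_nat_Suc)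

lemma V_rev: "V j (rev w) = (-1) ^ (e w + M * d w) * V (int M + 2 - j) w"
proof -
  have "(-1 :: real) ^ (M * d w) * ((-1) ^ M * alt_sign j) ^ d w = alt_sign j ^ d w"
    by (simp add: power_mult flip: power_mult_distrib mult.assoc)
  then show ?thesis
    by (simp add: udd_factor_def g_rev d_rev udd_length_reflect alt_sign_reflect power_add mult_ac)
qed

text \<open>Reversal turns the first \<open>j\<close> factors into the last \<open>j\<close> ones,
  twisted by \<open>c\<close>; multiplied by the twisted remaining \<open>M + 1 - j\<close> factors
  they give the full product.\<close>

lemma X_rev_aux:
  fixes c :: "'a list \<Rightarrow> real"
  defines "c \<equiv> \<lambda>w. (-1) ^ (e w + M * d w)"
  assumes "j \<le> M + 1"
  shows "(\<lambda>w. X j (rev w)) \<star> (\<lambda>w. c w * X (M + 1 - j) w) = (\<lambda>w. c w * X (M + 1) w)"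
  using assms(2)
proof (induction j)
  case 0
  have "(\<lambda>w. unit_series (rev w)) = (unit_series :: 'a list \<Rightarrow> real)" by (auto simp: unit_series_def)
  then show ?case by simp
next
  case (Suc j)
  have c: "c (u @ v) = c u * c v" for u v
    by (simp add: c_def d_append e_append power_add algebra_simps)
  have k: "M + 1 - j = Suc (M + 1 - Suc j)" "int M + 2 - int (Suc j) = int (Suc (M + 1 - Suc j))"
    using Suc.prems by auto
  have "(\<lambda>w. X (Suc j) (rev w)) = (\<lambda>w. X j (rev w)) \<star> (\<lambda>w. c w * V (int (M + 1 - j)) w)"
    unfolding udd_product.simps conv_rev V_rev k c_def by (intro ext) simp
  then have "(\<lambda>w. X (Suc j) (rev w)) \<star> (\<lambda>w. c w * X (M + 1 - Suc j) w)
     = (\<lambda>w. X j (rev w)) \<star> ((\<lambda>w. c w * V (int (M + 1 - j)) w) \<star> (\<lambda>w. c w * X (M + 1 - Suc j) w))"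
    by (simp only: conv_assoc)
  also have "\<dots> = (\<lambda>w. X j (rev w)) \<star> (\<lambda>w. c w * X (M + 1 - j) w)"
    unfolding conv_twist[of c, OF c] k by simp
  also have "\<dots> = (\<lambda>w. c w * X (M + 1) w)" using Suc by simp
  finally show ?case .
qed

lemma X_rev: "X (M + 1) (rev w) = (-1) ^ (e w + M * d w) * X (M + 1) w"
proof -
  have "(\<lambda>w. (-1) ^ (e w + M * d w) * unit_series w) = (unit_series :: 'a list \<Rightarrow> real)"
    by (auto simp: unit_series_def)
  then show ?thesis using fun_cong[OF X_rev_aux[of "M + 1"], of w] by simp
qed

text \<open>The extension of \<open>X\<close> to negative indices for which \<open>Z_step\<close> holds at every integer.\<close>

definition Z :: "int \<Rightarrow> 'a list \<Rightarrow> real"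
  where "Z j w = (if 0 \<le> j then X (nat j) w else (-1) ^ (d w + e w) * X (nat (- j)) w)"

lemma Z_neg: "Z (- j) w = (-1) ^ (d w + e w) * Z j w"
proof -
  have "(-1 :: real) ^ (d w + e w) * (-1) ^ (d w + e w) = 1" by (simp flip: power_mult_distrib)
  moreover have "w \<noteq> [] \<Longrightarrow> X 0 w = 0" by (simp add: unit_series_def)
  ultimately show ?thesis
    by (cases "j = 0"; cases "w = []") (auto simp: Z_def simp flip: mult.assoc)
qed

text \<open>From \<open>j + 1\<close> to \<open>- j\<close> both the interval length and the
  alternating sign change sign. With \<open>g_rev\<close> this makes the second factor the antipode
  of the first.\<close>

lemma V_neg_inverse: "V (- j) \<star> (\<lambda>w. (-1) ^ (d w + e w) * V (j + 1) w) = unit_series"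
proof -
  let ?c = "\<lambda>w. (- udd_length M (j + 1)) ^ length w * (- alt_sign (j + 1)) ^ d w"
  have "V (- j) \<star> (\<lambda>w. (-1) ^ (d w + e w) * V (j + 1) w)
      = (\<lambda>w. ?c w * g w) \<star> (\<lambda>w. ?c w * antipode g w)"
  proof (rule arg_cong2[where f = conv]; rule ext)
    fix w
    show "V (- j) w = ?c w * g w" by (simp add: udd_factor_def udd_length_neg alt_sign_neg)
    have "(- udd_length M (j + 1)) ^ length w * (-1) ^ length w = udd_length M (j + 1) ^ length w"
      by (simp flip: power_mult_distrib)
    moreover have "(- alt_sign (j + 1)) ^ d w = (-1) ^ d w * alt_sign (j + 1) ^ d w"
      by (simp flip: power_mult_distrib)
    ultimately show "(-1) ^ (d w + e w) * V (j + 1) w = ?c w * antipode g w"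
      by (simp add: udd_factor_def antipode_def g_rev power_add mult_ac)
  qed
  also have "\<dots> = (\<lambda>w. ?c w * unit_series w)"
    by (subst conv_twist) (auto simp: d_append power_add g_antipode)
  also have "\<dots> = unit_series" by (auto simp: unit_series_def)
  finally show ?thesis .
qed

text \<open>For \<open>j = - k \<le> 0\<close> the factor \<open>V j\<close> cancels the leading
  factor of the twisted product \<open>X (k + 1)\<close>; this is why \<open>Z\<close> carries the
  sign \<open>(-1) ^ (d w + e w)\<close>.\<close>

lemma Z_step: "Z j = V j \<star> Z (j - 1)"
proof (cases "1 \<le> j")
  case True
  then have n: "nat j = Suc (nat (j - 1))" by simp
  have "Z j = X (nat j)" "Z (j - 1) = X (nat (j - 1))" using True by (auto simp: Z_def)
  moreover have "int (Suc (nat (j - 1))) = j" using True by simp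
  ultimately show ?thesis unfolding n udd_product.simps by simp
next
  case False
  define k where "k = nat (- j)"
  have j: "j = - int k" using False by (simp add: k_def)
  let ?c = "\<lambda>w. (-1) ^ (d w + e w) :: real"
  have Zk: "Z (- int n) = (\<lambda>w. ?c w * X n w)" for n
    using Z_neg[of "int n"] by (auto simp: Z_def)
  have "V j \<star> Z (j - 1) = V (- int k) \<star> (\<lambda>w. ?c w * X (Suc k) w)"
  proof -
    have "j - 1 = - int (Suc k)" by (simp add: j)
    then show ?thesis by (simp only: Zk j)
  qed
  also have "(\<lambda>w. ?c w * X (Suc k) w) = (\<lambda>w. ?c w * V (int k + 1) w) \<star> (\<lambda>w. ?c w * X k w)"
    by (subst conv_twist) (auto simp: d_append e_append power_add add.commute)
  also have "V (- int k) \<star> \<dots> = (\<lambda>w. ?c w * X k w)"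
    by (simp add: V_neg_inverse flip: conv_assoc)
  finally show ?thesis using Zk[of k] by (simp add: j)
qed

end

subsection \<open>Trigonometric sequences\<close>

lemma real_add_one_nonzero [simp]: "real n + 1 \<noteq> 0"
  by linarith

lemma cos_add_2pi_int: "cos (x + 2 * pi * of_int n) = cos x"
  by (simp add: cos_add cos_int_2pin sin_int_2pin)

text \<open>\<open>q\<close> collects the frequencies of the interval lengths in units of pi / (M +
  1), and \<open>p\<close> those of the alternating signs, \<open>freq M 0 1\<close> being
  pi.\<close>

definition freq :: "nat \<Rightarrow> int \<Rightarrow> int \<Rightarrow> real"
  where "freq M q p = of_int (q + p * (int M + 1)) * (pi / (real M + 1))"

lemma freq_0 [simp]: "freq M 0 0 = 0"
  by (simp add: freq_def)

lemma freq_add: "freq M (q + q') (p + p') = freq M q p + freq M q' p'"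
  and freq_diff: "freq M (q - q') (p - p') = freq M q p - freq M q' p'"
proof -
  define t where "t = pi / (real M + 1)"
  show "freq M (q + q') (p + p') = freq M q p + freq M q' p'"
    "freq M (q - q') (p - p') = freq M q p - freq M q' p'"
    unfolding freq_def t_def[symmetric] by (simp_all add: algebra_simps)
qed

lemma freq_period: "freq M q p * (2 * (real M + 1)) = 2 * pi * of_int (q + p * (int M + 1))"
proof -
  have "pi / (real M + 1) * (2 * (real M + 1)) = 2 * pi" by (simp add: field_simps)
  then have "of_int n * (pi / (real M + 1)) * (2 * (real M + 1)) = 2 * pi * of_int n" for n
    by (simp only: mult.assoc) (simp only: mult_ac)
  then show ?thesis by (simp only: freq_def)
qed

text \<open>\<open>k\<close> bounds the number of interval lengths multiplied, and the parity of
  \<open>\<rho>\<close> is that of the number of alternating signs. Phases are free, so index shifts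
  preserve the class.\<close>

inductive_set trig_class :: "nat \<Rightarrow> nat \<Rightarrow> nat \<Rightarrow> (int \<Rightarrow> real) set" for M \<rho> k where
  wave: "\<lbrakk>\<bar>q\<bar> \<le> int k; even (p + int \<rho>)\<rbrakk> \<Longrightarrow>
    (\<lambda>j. cos (freq M q p * of_int j + \<phi>)) \<in> trig_class M \<rho> k"
| add: "\<lbrakk>x \<in> trig_class M \<rho> k; y \<in> trig_class M \<rho> k\<rbrakk> \<Longrightarrow> (\<lambda>j. x j + y j) \<in> trig_class M \<rho> k"
| scale: "x \<in> trig_class M \<rho> k \<Longrightarrow> (\<lambda>j. c * x j) \<in> trig_class M \<rho> k"

lemma trig_class_zero: "(\<lambda>_. 0) \<in> trig_class M \<rho> k"
proof -
  have "(\<lambda>j. 0 * cos (freq M 0 (int \<rho>) * of_int j + 0)) \<in> trig_class M \<rho> k"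
    by (intro trig_class.scale trig_class.wave) auto
  then show ?thesis by simp
qed

lemma trig_class_const:
  assumes "even \<rho>" shows "(\<lambda>_. c) \<in> trig_class M \<rho> k"
proof -
  have "(\<lambda>j. c * cos (freq M 0 0 * of_int j + 0)) \<in> trig_class M \<rho> k"
    by (intro trig_class.scale trig_class.wave) (use assms in auto)
  then show ?thesis by simp
qed

lemma trig_class_sum:
  assumes "finite I" "\<And>i. i \<in> I \<Longrightarrow> x i \<in> trig_class M \<rho> k"
  shows "(\<lambda>j. \<Sum>i\<in>I. x i j) \<in> trig_class M \<rho> k"
  using assms by (induction I) (auto simp: trig_class_zero intro: trig_class.add)

lemma trig_class_shift:
  assumes "x \<in> trig_class M \<rho> k"
  shows "(\<lambda>j. x (j - 1)) \<in> trig_class M \<rho> k"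
  using assms
proof induction
  case (wave q p \<phi>)
  let ?a = "freq M q p"
  have "(\<lambda>j::int. cos (?a * of_int j + (\<phi> - ?a))) \<in> trig_class M \<rho> k"
    by (rule trig_class.wave) (use wave in auto)
  moreover have "?a * of_int j + (\<phi> - ?a) = ?a * of_int (j - 1) + \<phi>" for j :: int
    by (simp add: algebra_simps)
  ultimately show ?case by (simp only:)
qed (auto intro: trig_class.intros)

lemma trig_class_mult_wave:
  assumes y: "y \<in> trig_class M \<rho>' k'" and q: "\<bar>q\<bar> \<le> int k" "even (p + int \<rho>)"
  shows "(\<lambda>j. cos (freq M q p * of_int j + \<phi>) * y j)
           \<in> trig_class M (\<rho> + \<rho>') (k + k')"
  using y
proof induction
  case (wave q' p' \<phi>')
  let ?a = "freq M q p"
  let ?a' = "freq M q' p'"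
  have "(\<lambda>j. 1/2 * (cos (freq M (q - q') (p - p') * of_int j + (\<phi> - \<phi>'))
      + cos (freq M (q + q') (p + p') * of_int j + (\<phi> + \<phi>'))))
      \<in> trig_class M (\<rho> + \<rho>') (k + k')"
    by (intro trig_class.scale trig_class.add trig_class.wave) (use wave q in auto)
  moreover have "freq M (q - q') (p - p') * of_int j + (\<phi> - \<phi>')
      = (?a * of_int j + \<phi>) - (?a' * of_int j + \<phi>')"
    "freq M (q + q') (p + p') * of_int j + (\<phi> + \<phi>')
      = (?a * of_int j + \<phi>) + (?a' * of_int j + \<phi>')" for j :: int
    by (simp_all add: freq_add freq_diff algebra_simps)
  ultimately show ?case by (simp only: cos_times_cos) simp
next
  case (add x y)
  then show ?case by (simp add: distrib_left trig_class.add)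
next
  case (scale x c)
  then show ?case by (simp add: mult.left_commute trig_class.scale)
qed

lemma trig_class_mult:
  assumes "x \<in> trig_class M \<rho> k" "y \<in> trig_class M \<rho>' k'"
  shows "(\<lambda>j. x j * y j) \<in> trig_class M (\<rho> + \<rho>') (k + k')"
  using assms(1)
proof induction
  case (wave q p \<phi>)
  then show ?case using trig_class_mult_wave[OF assms(2)] by blast
next
  case (add x y)
  then show ?case by (simp add: distrib_right trig_class.add)
next
  case (scale x c)
  then show ?case by (simp add: mult.assoc trig_class.scale)
qed

lemma trig_class_power:
  assumes "x \<in> trig_class M \<rho> k"
  shows "(\<lambda>j. x j ^ n) \<in> trig_class M (n * \<rho>) (n * k)"
proof (induction n)
  case 0
  show ?case using trig_class_const[of 0 1] by simp
next
  case (Suc n)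
  show ?case using trig_class_mult[OF assms Suc] by simp
qed

lemma udd_length_trig: "udd_length M \<in> trig_class M 0 1"
proof -
  let ?t = "pi / (real M + 1)"
  have wave: "(\<lambda>j. sin (pi / (2 * (real M + 1))) *
      cos (freq M 1 0 * of_int j + (- ?t / 2 - pi / 2))) \<in> trig_class M 0 1"
    by (intro trig_class.scale trig_class.wave) auto
  have "(2 * of_int j - 1) * pi / (2 * (real M + 1)) = ?t * of_int j + (- ?t / 2 - pi / 2) + pi / 2" for j :: int
  proof -
    have "(2 * of_int j - 1) * pi / (2 * (real M + 1)) = (2 * of_int j - 1) / 2 * ?t" by simp
    moreover have "(2 * of_int j - 1) / 2 * t = t * of_int j + (- t / 2 - pi / 2) + pi / 2" for t :: real
      by (simp add: field_simps)
    ultimately show ?thesis by (simp only:)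
  qed
  moreover have "sin (x + pi / 2) = cos x" for x :: real
    by (simp add: sin_add)
  ultimately have "sin ((2 * of_int j - 1) * pi / (2 * (real M + 1))) = cos (?t * of_int j + (- ?t / 2 - pi / 2))" for j :: int
    by (simp only:)
  moreover have "freq M 1 0 = ?t" by (simp add: freq_def)
  ultimately show ?thesis using wave by (simp only: udd_length_def[abs_def])
qed

lemma alt_sign_trig: "alt_sign \<in> trig_class M 1 0"
proof -
  have "(\<lambda>j. cos (freq M 0 1 * of_int j + (- pi))) \<in> trig_class M 1 0"
    by (rule trig_class.wave) auto
  moreover have "cos (freq M 0 1 * of_int j + (- pi)) = alt_sign j" for j :: int
  proof -
    have "freq M 0 1 * of_int j + (- pi) = of_int j * pi - pi"
      by (simp add: freq_def)
    moreover have "cos (of_int j * pi) = (if even j then 1 else -1)"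
      using cos_int_times_real[of j pi] by (simp add: cos_npi_int mult.commute)
    ultimately show ?thesis by (simp only: cos_diff) (simp add: alt_sign_def)
  qed
  ultimately show ?thesis by simp
qed

lemma trig_class_periodic:
  assumes "x \<in> trig_class M \<rho> k"
  shows "x (j + 2 * (int M + 1)) = x j"
  using assms
proof induction
  case (wave q p \<phi>)
  let ?n = "q + p * (int M + 1)"
  have "freq M q p * of_int (j + 2 * (int M + 1)) + \<phi>
      = (freq M q p * of_int j + \<phi>) + 2 * pi * of_int ?n"
    unfolding freq_period[symmetric] by (simp add: algebra_simps)
  then show ?case by (simp only: cos_add_2pi_int)
qed auto

text \<open>A wave of frequency \<open>a\<close> is a difference of waves unless \<open>a\<close> is
  a multiple of 2 pi. At resonance \<open>q\<close> is a multiple of \<open>M + 1\<close>, so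
  \<open>\<bar>q\<bar> \<le> k \<le> M\<close> forces \<open>q = 0\<close> and \<open>p\<close>
  even: the wave is constant and \<open>\<rho>\<close> is even.\<close>

lemma trig_class_antidifference:
  assumes "x \<in> trig_class M \<rho> k" "k \<le> M"
  shows "\<exists>y L. y \<in> trig_class M \<rho> k \<and> (\<forall>j. x j = y j - y (j - 1) + L) \<and> (odd \<rho> \<longrightarrow> L = 0)"
  using assms(1)
proof induction
  case (wave q p \<phi>)
  let ?n = "q + p * (int M + 1)"
  define a where "a = freq M q p"
  show ?case
  proof (cases "sin (a / 2) = 0")
    case False
    \<comment> \<open>From sin (x + a/2) - sin (x - a/2) = 2 sin (a/2) cos x, the sines written as
      cosines shifted by pi / 2.\<close>
    have "(\<lambda>j. 1 / (2 * sin (a / 2)) * cos (a * of_int j + (\<phi> + a / 2 - pi / 2))) \<in> trig_class M \<rho> k"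
      unfolding a_def by (intro trig_class.scale trig_class.wave wave)
    moreover have "cos (a * of_int j + (\<phi> + a / 2 - pi / 2)) - cos (a * of_int (j - 1) + (\<phi> + a / 2 - pi / 2))
        = 2 * sin (a / 2) * cos (a * of_int j + \<phi>)" for j :: int
    proof -
      have "a * of_int j + (\<phi> + a / 2 - pi / 2) = (a * of_int j + \<phi>) + a / 2 - pi / 2"
        "a * of_int (j - 1) + (\<phi> + a / 2 - pi / 2) = (a * of_int j + \<phi>) - a / 2 - pi / 2"
        by (simp_all add: algebra_simps)
      then show ?thesis
        by (simp only: cos_diff[of _ "pi / 2"] cos_pi_half sin_pi_half sin_add sin_diff) simp
    qed
    then have "cos (a * of_int j + \<phi>) = 1 / (2 * sin (a / 2)) * cos (a * of_int j + (\<phi> + a / 2 - pi / 2))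
        - 1 / (2 * sin (a / 2)) * cos (a * of_int (j - 1) + (\<phi> + a / 2 - pi / 2)) + 0" for j :: int
      using False by (simp only: flip: right_diff_distrib) simp
    ultimately show ?thesis unfolding a_def by blast
  next
    case True
    then obtain i where "a / 2 = of_int i * pi" by (auto simp: sin_zero_iff_int2)
    then have "a = 2 * of_int i * pi" by simp
    then have "of_int ?n * pi / (real M + 1) = 2 * of_int i * pi" by (simp add: a_def freq_def)
    then have "of_int ?n * pi = 2 * of_int i * (real M + 1) * pi" by (simp add: divide_eq_eq mult_ac)
    then have "real_of_int ?n = 2 * of_int i * (real M + 1)" by (simp only: mult_cancel_right) simp
    then have "real_of_int ?n = of_int (2 * i * (int M + 1))" by simp
    then have n: "q = (2 * i - p) * (int M + 1)" by (simp only: of_int_eq_iff) (simp add: algebra_simps)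
    have "2 * i - p = 0"
    proof (rule ccontr)
      assume "2 * i - p \<noteq> 0"
      then have "1 * (int M + 1) \<le> \<bar>2 * i - p\<bar> * \<bar>int M + 1\<bar>" by (intro mult_mono) auto
      also have "\<dots> = \<bar>q\<bar>" by (simp only: n abs_mult)
      finally show False using wave(1) assms(2) by simp
    qed
    then have p: "p = 2 * i" "q = 0" using n by auto
    then have "even \<rho>" using wave(2) by simp
    have "cos (a * of_int j + \<phi>) = cos \<phi>" for j :: int
    proof -
      have "a * of_int j + \<phi> = \<phi> + 2 * pi * of_int (i * j)" using p by (simp add: a_def freq_def field_simps)
      then show ?thesis by (simp only: cos_add_2pi_int)
    qed
    then show ?thesis unfolding a_def using \<open>even \<rho>\<close> trig_class_zero by fastforce
  qed
next
  case (add x y)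
  then obtain u L v L' where "u \<in> trig_class M \<rho> k" "\<forall>j. x j = u j - u (j - 1) + L" "odd \<rho> \<longrightarrow> L = 0"
    "v \<in> trig_class M \<rho> k" "\<forall>j. y j = v j - v (j - 1) + L'" "odd \<rho> \<longrightarrow> L' = 0" by blast
  then show ?case
    by (intro exI[of _ "\<lambda>j. u j + v j"] exI[of _ "L + L'"]) (auto intro: trig_class.add)
next
  case (scale x c)
  then obtain u L where "u \<in> trig_class M \<rho> k" "\<forall>j. x j = u j - u (j - 1) + L" "odd \<rho> \<longrightarrow> L = 0" by blast
  then show ?case
    by (intro exI[of _ "\<lambda>j. c * u j"] exI[of _ "c * L"]) (auto intro: trig_class.scale simp: right_diff_distrib distrib_left)
qed

lemma int_telescope:
  fixes h :: "int \<Rightarrow> real"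
  assumes "\<And>j. h j - h (j - 1) = L"
  shows "h j = h 0 + L * of_int j"
proof (induction j rule: int_induct[where k = 0])
  case (step1 i)
  then show ?case using assms[of "i + 1"] by (simp add: algebra_simps)
next
  case (step2 i)
  then show ?case using assms[of i] by (simp add: algebra_simps)
qed simp

text \<open>The reflection symmetry excludes the constant (odd case) and linear (even case) terms that
  summation can produce.\<close>

lemma trig_class_summation:
  assumes x: "(\<lambda>j. h j - h (j - 1)) \<in> trig_class M \<rho> k" and k: "k \<le> M"
    and h: "\<And>j. h (- j) = (-1) ^ \<rho> * h j"
  shows "h \<in> trig_class M \<rho> k"
proof -
  let ?T = "2 * (int M + 1)"
  obtain y L where y: "y \<in> trig_class M \<rho> k" "\<And>j. h j - h (j - 1) = y j - y (j - 1) + L" "odd \<rho> \<Longrightarrow> L = 0"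
    using trig_class_antidifference[OF x k] by blast
  define C where "C = h 0 - y 0"
  have hy: "h j = y j + C + L * of_int j" for j
    using int_telescope[of "\<lambda>j. h j - y j" L j] y(2) by (simp add: C_def algebra_simps)
  have yT: "y (- ?T) = y 0" "y ?T = y 0"
    using trig_class_periodic[OF y(1), of "- ?T"] trig_class_periodic[OF y(1), of 0] by auto
  show ?thesis
  proof (cases "even \<rho>")
    case True
    \<comment> \<open>The periodic \<open>y\<close> and the even \<open>h\<close> agree at the two
      points; only the linear term could tell them apart.\<close>
    then have "h (- ?T) = h ?T" using h[of ?T] by simp
    then have "L * of_int ?T = 0" using yT by (simp add: hy)
    then have "L = 0" by simp
    then have "h = (\<lambda>j. y j + C)" by (auto simp: hy)
    then show ?thesis using y(1) True by (auto intro: trig_class.add trig_class_const)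
  next
    case False
    then have L: "L = 0" by (rule y(3))
    \<comment> \<open>In an odd class \<open>y\<close> is itself a difference without drift, so it
      sums to zero over a period in either direction. Summing
      \<open>2 * C = - (y i + y (- i))\<close> over a period then gives
      \<open>C = 0\<close>.\<close>
    obtain z where z: "z \<in> trig_class M \<rho> k" "\<And>j. y j = z j - z (j - 1)"
      using trig_class_antidifference[OF y(1) k] False by auto
    have sums: "(\<Sum>i<n. y (int i)) = z (int n - 1) - z (- 1)" "(\<Sum>i<n. y (- int i)) = z 0 - z (- int n)" for n
      by (induction n) (auto simp: z(2) minus_diff_commute)
    let ?n = "2 * (M + 1)"
    have "(\<Sum>i<?n. y (int i)) = 0" "(\<Sum>i<?n. y (- int i)) = 0"
      using trig_class_periodic[OF z(1), of "- 1"] trig_class_periodic[OF z(1), of "- ?T"]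
      unfolding sums by (auto simp: algebra_simps)
    moreover have C: "2 * C = - (y (int i) + y (- int i))" for i
      using h[of "int i"] False by (simp add: hy L)
    have "(\<Sum>i<?n. 2 * C) = (\<Sum>i<?n. - (y (int i) + y (- int i)))"
      by (rule sum.cong) (use C in auto)
    then have "(\<Sum>i<?n. 2 * C) = - ((\<Sum>i<?n. y (int i)) + (\<Sum>i<?n. y (- int i)))"
      by (simp only: sum.distrib sum_negf)
    ultimately have "C = 0" by simp
    then have "h = y" by (auto simp: hy L)
    then show ?thesis using y(1) by simp
  qed
qed

section \<open>Suppression of words by one outer layer\<close>

context udd_layer
begin

lemma V_trig: "(\<lambda>j. V j w) \<in> trig_class M (d w) (length w)"
proof -
  have "(\<lambda>j. udd_length M j ^ length w * alt_sign j ^ d w) \<in> trig_class M (d w) (length w)"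
    using trig_class_mult[OF trig_class_power[OF udd_length_trig, where n = "length w"]
      trig_class_power[OF alt_sign_trig, where n = "d w"]] by simp
  then have "(\<lambda>j. g w * (udd_length M j ^ length w * alt_sign j ^ d w)) \<in> trig_class M (d w) (length w)"
    by (rule trig_class.scale)
  then show ?thesis by (simp add: udd_factor_def mult_ac)
qed

text \<open>Induction on the length: the increment of \<open>Z\<close> is a sum over nonempty
  prefixes, where suffixes of even \<open>e\<close> are in their class by induction and those of odd
  \<open>e\<close> contribute zero. Summing requires the parity of \<open>d w + e w\<close> to be
  that of \<open>d w\<close>, hence even \<open>e w\<close>.\<close>

lemma Z_trig:
  assumes "length w \<le> M" "length w \<le> n" "even (e w)"
    and odd_zero: "\<And>u j. odd (e u) \<Longrightarrow> length u < n \<Longrightarrow> Z j u = 0"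
  shows "(\<lambda>j. Z j w) \<in> trig_class M (d w) (length w)"
  using assms(1-3)
proof (induction w rule: length_induct)
  case (1 w)
  have diff: "Z j w - Z (j - 1) w = (\<Sum>i\<in>{1..length w}. V j (take i w) * Z (j - 1) (drop i w))" for j
  proof -
    have "Z j w = (\<Sum>i\<le>length w. V j (take i w) * Z (j - 1) (drop i w))"
      by (subst Z_step) (simp add: conv_def)
    also have "{..length w} = insert 0 {1..length w}" by auto
    finally show ?thesis by simp
  qed
  have "(\<lambda>j. V j (take i w) * Z (j - 1) (drop i w)) \<in> trig_class M (d w) (length w)"
    if i: "i \<in> {1..length w}" for i
  proof (cases "even (e (drop i w))")
    case True
    have "(\<lambda>j. Z j (drop i w)) \<in> trig_class M (d (drop i w)) (length (drop i w))"
    proof -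
      have "length (drop i w) < length w" "length (drop i w) \<le> M" "length (drop i w) \<le> n" using 1 i by auto
      then show ?thesis using "1.IH" True by blast
    qed
    from trig_class_mult[OF V_trig[of "take i w"] trig_class_shift[OF this]]
    show ?thesis using i by (simp flip: d_append)
  next
    case False
    moreover have "length (drop i w) < n" using i 1 by auto
    ultimately have "Z j (drop i w) = 0" for j using odd_zero by blast
    then show ?thesis by (simp add: trig_class_zero)
  qed
  then have "(\<lambda>j. Z j w - Z (j - 1) w) \<in> trig_class M (d w) (length w)"
    unfolding diff by (intro trig_class_sum) auto
  then show ?case
    by (rule trig_class_summation) (use 1 in \<open>auto simp: Z_neg power_add\<close>)
qed

theorem X_eq_zero:
  assumes "length w \<le> M" "length w \<le> n" "even (e w)" "odd (d w)"
    and "\<And>u j. odd (e u) \<Longrightarrow> length u < n \<Longrightarrow> X j u = 0"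
  shows "X (M + 1) w = 0"
proof -
  have "(\<lambda>j. Z j w) \<in> trig_class M (d w) (length w)"
    by (rule Z_trig[where n = n]) (use assms in \<open>auto simp: Z_def\<close>)
  \<comment> \<open>The period \<open>2 * (M + 1)\<close> identifies \<open>M + 1\<close> with
    \<open>- (M + 1)\<close>, while \<open>Z\<close> is odd because \<open>d w + e w\<close>
    is.\<close>
  from trig_class_periodic[OF this, of "- (int M + 1)"]
  have "Z (int M + 1) w = Z (- (int M + 1)) w" by simp
  also have "\<dots> = - Z (int M + 1) w" unfolding Z_neg using assms by simp
  finally have "Z (int (M + 1)) w = 0" by (simp add: algebra_simps)
  then show ?thesis by (simp only: Z_def of_nat_0_le_iff nat_int if_True)
qed

theorem X_vanishes_below:
  assumes K: "\<And>u v. K (u @ v) \<le> K u + K v" and g: "vanishes_below K g"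
  shows "vanishes_below K (X j)"
proof (induction j)
  case 0
  show ?case by (simp add: vanishes_below_def unit_series_def)
next
  case (Suc j)
  have "vanishes_below K (V i)" for i using g by (auto simp: vanishes_below_def udd_factor_def)
  then show ?case unfolding udd_product.simps using Suc K by (intro vanishes_below_conv) auto
qed

text \<open>Up to one order past \<open>K w\<close> the product is additive in its factors. The
  reflection of \<open>i\<close> to \<open>M + 2 - i\<close> keeps interval lengths and, for odd
  \<open>M\<close> and odd \<open>d w\<close>, flips the sign of each term.\<close>

theorem X_bonus:
  assumes K: "\<And>u v. K (u @ v) \<le> K u + K v" and g: "vanishes_below K g"
    and w: "w \<noteq> []" "length w \<le> K w + 1" and odd: "odd M" "odd (d w)"
  shows "X (M + 1) w = 0"
proof -
  have V: "vanishes_below K (V i)" for i using g by (auto simp: vanishes_below_def udd_factor_def)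
  have sum: "X j w = (\<Sum>i\<in>{1..j}. V (int i) w)" for j
  proof (induction j)
    case 0
    show ?case using w by (simp add: unit_series_def)
  next
    case (Suc j)
    have "X (Suc j) w = V (int (Suc j)) w * X j [] + V (int (Suc j)) [] * X j w"
      unfolding udd_product.simps using K V X_vanishes_below[OF K g] w by (intro conv_vanishing) auto
    then show ?case using Suc by simp
  qed
  have refl: "V (int (M + 2 - i)) w = - V (int i) w" if "i \<in> {1..M+1}" for i
  proof -
    have "int (M + 2 - i) = int M + 2 - int i" using that by auto
    then show ?thesis
      using odd by (simp add: udd_factor_def udd_length_reflect alt_sign_reflect)
  qed
  have "(\<Sum>i\<in>{1..M+1}. V (int i) w) = (\<Sum>i\<in>{1..M+1}. V (int (M + 2 - i)) w)"
    by (rule sum.reindex_bij_witness[of _ "\<lambda>i. M + 2 - i" "\<lambda>i. M + 2 - i"]) auto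
  also have "\<dots> = (\<Sum>i\<in>{1..M+1}. - V (int i) w)"
    by (rule sum.cong) (simp_all only: refl)
  also have "\<dots> = - (\<Sum>i\<in>{1..M+1}. V (int i) w)" by (rule sum_negf)
  finally show ?thesis by (simp only: sum)
qed

end

subsection \<open>Suppression orders and induction on the layers\<close>

definition letter_count :: "nat \<Rightarrow> (nat \<Rightarrow> nat) list \<Rightarrow> nat"
  where "letter_count i w = (\<Sum>x\<leftarrow>w. x i)"

definition word_type :: "(nat \<Rightarrow> nat) list \<Rightarrow> nat \<Rightarrow> nat"
  where "word_type w i = letter_count i w mod 2"

text \<open>The exponent of the time reversal sign of the first \<open>l\<close> layers: by
  \<open>X_rev\<close>, layer \<open>i\<close> contributes \<open>N i\<close> for each letter it
  counts.\<close>

definition odd_weight :: "(nat \<Rightarrow> nat) \<Rightarrow> nat \<Rightarrow> (nat \<Rightarrow> nat) list \<Rightarrow> nat"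
  where "odd_weight N l w = (\<Sum>i=1..l. N i * letter_count i w)"

lemma letter_count_append: "letter_count i (u @ v) = letter_count i u + letter_count i v"
  by (simp add: letter_count_def)

lemma odd_weight_append: "odd_weight N l (u @ v) = odd_weight N l u + odd_weight N l v"
  by (simp add: odd_weight_def letter_count_append distrib_left sum.distrib)

lemma word_type_append: "word_type (u @ v) = (\<lambda>i. (word_type u i + word_type v i) mod 2)"
  by (auto simp: word_type_def letter_count_append mod_add_eq)

lemma parity_xor_less: "parity_xor N r a b < 2"
  by (simp add: parity_xor_def)

lemma parity_xor_Suc:
  "parity_xor N r 1 (Suc l) = (parity_xor N r 1 l + r (Suc l) * (N (Suc l) mod 2)) mod 2"
  by (simp add: parity_xor_def mod_add_left_eq)

lemma odd_weight_parity: "odd_weight N l w mod 2 = parity_xor N (word_type w) 1 l"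
proof (induction l)
  case 0
  show ?case by (simp add: odd_weight_def parity_xor_def)
next
  case (Suc l)
  have "odd_weight N (Suc l) w mod 2
      = (odd_weight N l w mod 2 + (N (Suc l) mod 2) * word_type w (Suc l)) mod 2"
    by (simp add: odd_weight_def word_type_def mod_add_left_eq mod_mult_eq
        flip: mod_add_right_eq[of _ "N (Suc l) * _"] mod_add_right_eq[of _ "N (Suc l) mod 2 * _"])
  then show ?case using Suc by (simp only: parity_xor_Suc) (simp add: mult.commute)
qed

lemma parity_xor_add:
  "parity_xor N (\<lambda>i. (a i + b i) mod 2) 1 l = (parity_xor N a 1 l + parity_xor N b 1 l) mod 2"
proof (induction l)
  case (Suc l)
  have "parity_xor N (\<lambda>i. (a i + b i) mod 2) 1 (Suc l)
      = ((parity_xor N a 1 l + parity_xor N b 1 l) + (a (Suc l) + b (Suc l)) * (N (Suc l) mod 2)) mod 2"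
    unfolding parity_xor_Suc[of N "\<lambda>i. (a i + b i) mod 2"] Suc by (metis mod_add_eq mod_mult_left_eq mod_mod_trivial)
  also have "\<dots> = (parity_xor N a 1 (Suc l) + parity_xor N b 1 (Suc l)) mod 2"
    unfolding parity_xor_Suc by (simp add: mod_add_eq algebra_simps)
  finally show ?case .
qed (simp add: parity_xor_def)

lemma parity_xor_cong:
  assumes "\<And>i. i \<in> {1..l} \<Longrightarrow> r i = r' i"
  shows "parity_xor N r 1 l = parity_xor N r' 1 l"
  unfolding parity_xor_def by (intro arg_cong2[where f = "(mod)"] sum.cong) (use assms in auto)

text \<open>\<open>suppression_order\<close> for an outermost layer \<open>i\<close>, without reference to the number of layers.\<close>

definition outer_order :: "(nat \<Rightarrow> nat) \<Rightarrow> nat \<Rightarrow> nat" where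
  "outer_order N i =
     (if \<forall>k\<in>{1..<i}. even (N k) then N i
      else min (Min {N k | k. 1 \<le> k \<and> k < i \<and> odd (N k)} + 1) (N i))"

lemma suppression_order_eq:
  assumes "i \<in> {1..l}" shows "suppression_order l N i = outer_order N i"
proof -
  have "(\<forall>k\<in>{1..l}. even (N k)) \<or> i \<le> first_odd l N \<longleftrightarrow> (\<forall>k\<in>{1..<i}. even (N k))"
  proof (cases "\<forall>k\<in>{1..l}. even (N k)")
    case True
    then show ?thesis using assms by auto
  next
    case False
    then have "\<exists>i. i \<in> {1..l} \<and> odd (N i)" by blast
    then have f: "first_odd l N \<in> {1..l}" "odd (N (first_odd l N))"
      unfolding first_odd_def by (metis (mono_tags, lifting) LeastI_ex)+
    have "even (N k)" if "k \<in> {1..<i}" "i \<le> first_odd l N" for k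
      using not_less_Least[of k "\<lambda>i. i \<in> {1..l} \<and> odd (N i)"] that assms by (auto simp: first_odd_def)
    moreover have "i \<le> first_odd l N" if "\<forall>k\<in>{1..<i}. even (N k)"
      by (rule ccontr) (use that f in auto)
    ultimately show ?thesis using False by blast
  qed
  then show ?thesis by (simp add: suppression_order_def outer_order_def)
qed

lemma finite_odd_orders:
  fixes N :: "nat \<Rightarrow> nat" shows "finite {N k | k. 1 \<le> k \<and> k < i \<and> odd (N k)}"
proof -
  have "{N k | k. 1 \<le> k \<and> k < i \<and> odd (N k)} \<subseteq> N ` {..<i}" by auto
  then show ?thesis by (rule finite_subset) simp
qed

lemma outer_order_le: "outer_order N i \<le> N i"
  by (simp add: outer_order_def)

lemma outer_order_ge:
  assumes "m \<le> N i" "\<And>k. k \<in> {1..<i} \<Longrightarrow> odd (N k) \<Longrightarrow> m \<le> N k"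
  shows "m \<le> outer_order N i"
proof (cases "\<forall>k\<in>{1..<i}. even (N k)")
  case False
  then have "Min {N k | k. 1 \<le> k \<and> k < i \<and> odd (N k)} \<in> {N k | k. 1 \<le> k \<and> k < i \<and> odd (N k)}"
    by (intro Min_in finite_odd_orders) auto
  then have "m \<le> Min {N k | k. 1 \<le> k \<and> k < i \<and> odd (N k)}" using assms(2) by auto
  then show ?thesis using assms(1) False by (simp only: outer_order_def if_False min.bounded_iff) simp
qed (use assms in \<open>simp add: outer_order_def\<close>)

lemma outer_order_le_odd:
  assumes "k \<in> {1..<i}" "odd (N k)"
  shows "outer_order N i \<le> N k + 1"
proof -
  have "Min {N k | k. 1 \<le> k \<and> k < i \<and> odd (N k)} \<le> N k"
    by (intro Min_le finite_odd_orders) (use assms in auto)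
  then show ?thesis using assms by (auto simp: outer_order_def)
qed

text \<open>The maximum of \<open>decoupling_order\<close> built outwards: a new outermost layer
  adds its parity term to all earlier candidates and enters with one of its own. The start value 0
  brings in the candidate \<open>parity_sum N r 1 l\<close>.\<close>

fun layer_order :: "(nat \<Rightarrow> nat) \<Rightarrow> (nat \<Rightarrow> nat) \<Rightarrow> nat \<Rightarrow> nat" where
  "layer_order N r 0 = 0"
| "layer_order N r (Suc l) =
     max (layer_order N r l + r (Suc l) * (N (Suc l) mod 2))
         (r (Suc l) * ((parity_xor N r 1 l + 1) mod 2) * outer_order N (Suc l))"

lemma decoupling_order_le:
  assumes "1 \<le> l" shows "decoupling_order l N r \<le> layer_order N r l"
proof -
  have "r i * ((parity_xor N r 1 (i - 1) + 1) mod 2) * outer_order N i + parity_sum N r (i + 1) l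
      \<le> layer_order N r l" if "i \<in> {1..l}" for i
    using that
  proof (induction l)
    case (Suc l)
    show ?case
    proof (cases "i = Suc l")
      case True
      then show ?thesis by (simp add: parity_sum_def)
    next
      case False
      then have "parity_sum N r (i + 1) (Suc l) = parity_sum N r (i + 1) l + r (Suc l) * (N (Suc l) mod 2)"
        using Suc.prems by (simp add: parity_sum_def)
      then show ?thesis using Suc False by auto
    qed
  qed simp
  then show ?thesis
    unfolding decoupling_order_def using assms by (subst Max_le_iff) (auto simp: suppression_order_eq)
qed

lemma layer_order_cong:
  assumes "\<And>i. i \<in> {1..l} \<Longrightarrow> r i = r' i"
  shows "layer_order N r l = layer_order N r' l"
  using assms
proof (induction l)
  case (Suc l)
  then have "layer_order N r l = layer_order N r' l" "r (Suc l) = r' (Suc l)"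
    "parity_xor N r 1 l = parity_xor N r' 1 l" by (auto simp del: One_nat_def intro!: parity_xor_cong)
  then show ?case by simp
qed simp

text \<open>The running parity must jump from 0 to 1 at some layer. That layer is odd and has bit 1,
  so its \<open>outer_order\<close>, which is at least \<open>m\<close>, enters the maximum and
  persists further out.\<close>

lemma layer_order_ge_odd:
  assumes "parity_xor N r 1 l = 1" "\<And>i. r i < 2"
    and "\<And>k. k \<in> {1..l} \<Longrightarrow> odd (N k) \<Longrightarrow> m \<le> N k"
  shows "m \<le> layer_order N r l"
  using assms(1,3)
proof (induction l)
  case 0
  then show ?case by (simp add: parity_xor_def)
next
  case (Suc l)
  show ?case
  proof (cases "parity_xor N r 1 l = 1")
    case True
    then have "m \<le> layer_order N r l" using Suc by auto
    then show ?thesis by simp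
  next
    case False
    then have p: "parity_xor N r 1 l = 0" using parity_xor_less[of N r 1 l] by linarith
    have "odd (N (Suc l))" and r: "r (Suc l) = 1"
      using Suc.prems(1) assms(2)[of "Suc l"] unfolding parity_xor_Suc p
      by (auto simp: less_2_cases_iff odd_iff_mod_2_eq_one intro!: ccontr[of "odd _"])
    then have "m \<le> outer_order N (Suc l)" using Suc.prems by (intro outer_order_ge) auto
    then show ?thesis using p r by simp
  qed
qed

text \<open>If both inner parities are 0, the bit of \<open>a\<close> makes
  \<open>outer_order\<close> a candidate. If both are 1, each order is at least the least odd inner
  \<open>N k\<close>, and \<open>outer_order\<close> is at most
  \<open>N k + 1 \<le> 2 * N k\<close>.\<close>

lemma layer_order_subadditive_aux:
  assumes a: "\<And>i. a i < 2" and b: "\<And>i. b i < 2" and N: "\<And>k. k \<in> {1..l} \<Longrightarrow> 1 \<le> N k"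
    and p: "parity_xor N a 1 l = parity_xor N b 1 l" and ab: "a (Suc l) = 1"
  shows "outer_order N (Suc l) \<le> layer_order N a (Suc l) + layer_order N b (Suc l)"
proof (cases "parity_xor N a 1 l = 0")
  case True
  then show ?thesis using ab by simp
next
  case False
  then have p1: "parity_xor N a 1 l = 1" using parity_xor_less[of N a 1 l] by linarith
  have "\<exists>k\<in>{1..l}. odd (N k)"
  proof (rule ccontr)
    assume "\<not> ?thesis"
    then have "(\<Sum>k=1..l. a k * (N k mod 2)) = 0" by (auto simp: even_iff_mod_2_eq_zero)
    then show False using p1 by (simp only: parity_xor_def)
  qed
  then obtain k where k: "k \<in> {1..l}" "odd (N k)" "\<And>i. i \<in> {1..l} \<Longrightarrow> odd (N i) \<Longrightarrow> N k \<le> N i"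
    using ex_has_least_nat[of "\<lambda>k. k \<in> {1..l} \<and> odd (N k)" _ N] by blast
  have "N k \<le> layer_order N a l" "N k \<le> layer_order N b l"
    by (rule layer_order_ge_odd; use p p1 a b k in auto)+
  moreover have "outer_order N (Suc l) \<le> N k + 1" using k by (intro outer_order_le_odd) auto
  moreover have "1 \<le> N k" using N k by auto
  ultimately show ?thesis by simp
qed

text \<open>Supplies the hypothesis on \<open>K\<close> in \<open>conv_vanishing\<close>. Parity
  terms are subadditive bit by bit; the own term of the new layer counts only if exactly one bit is
  1 and the inner parities agree, as in \<open>layer_order_subadditive_aux\<close>.\<close>

lemma layer_order_subadditive:
  assumes a: "\<And>i. a i < 2" and b: "\<And>i. b i < 2" and N: "\<And>k. k \<in> {1..l} \<Longrightarrow> 1 \<le> N k"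
  shows "layer_order N (\<lambda>i. (a i + b i) mod 2) l \<le> layer_order N a l + layer_order N b l"
  using N
proof (induction l)
  case (Suc l)
  let ?c = "\<lambda>i. (a i + b i) mod 2"
  let ?n = "N (Suc l) mod 2"
  have "?c (Suc l) * ?n \<le> (a (Suc l) + b (Suc l)) * ?n" by (intro mult_right_mono) auto
  moreover have "layer_order N ?c l \<le> layer_order N a l + layer_order N b l" using Suc by auto
  ultimately have "layer_order N ?c l + ?c (Suc l) * ?n
      \<le> (layer_order N a l + a (Suc l) * ?n) + (layer_order N b l + b (Suc l) * ?n)"
    by (simp only: distrib_right)
  also have "\<dots> \<le> layer_order N a (Suc l) + layer_order N b (Suc l)"
    by (intro add_mono) auto
  finally have 1: "layer_order N ?c l + ?c (Suc l) * ?n \<le> layer_order N a (Suc l) + layer_order N b (Suc l)" .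
  have 2: "?c (Suc l) * ((parity_xor N ?c 1 l + 1) mod 2) * outer_order N (Suc l)
      \<le> layer_order N a (Suc l) + layer_order N b (Suc l)"
  proof (cases "?c (Suc l) = 1 \<and> parity_xor N ?c 1 l = 0")
    case False
    then have "?c (Suc l) * ((parity_xor N ?c 1 l + 1) mod 2) = 0"
      using parity_xor_less[of N ?c 1 l] by (auto simp: less_2_cases_iff)
    then show ?thesis by (simp only: mult_zero_left le0)
  next
    case True
    then have p: "parity_xor N a 1 l = parity_xor N b 1 l"
      using parity_xor_less[of N a 1 l] parity_xor_less[of N b 1 l] unfolding parity_xor_add
      by (auto simp: less_2_cases_iff)
    have "a (Suc l) = 1 \<or> b (Suc l) = 1" using True a[of "Suc l"] b[of "Suc l"] by (auto simp: less_2_cases_iff)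
    then have "outer_order N (Suc l) \<le> layer_order N a (Suc l) + layer_order N b (Suc l)"
      using layer_order_subadditive_aux[of a b l N] layer_order_subadditive_aux[of b a l N] a b p Suc.prems
      by (auto simp only: add.commute atLeastAtMost_iff le_SucI)
    moreover have "?c (Suc l) * ((parity_xor N ?c 1 l + 1) mod 2) = 1" using True by simp
    ultimately show ?thesis by simp
  qed
  show ?case using 1 2 by simp
qed simp

text \<open>Without layers all integrands are 1 and the coefficient is the volume of a simplex;
  \<open>iterated_letter_function\<close> identifies the recursion with the iterated
  integrals.\<close>

fun nudd_series :: "(nat \<Rightarrow> nat) \<Rightarrow> nat \<Rightarrow> (nat \<Rightarrow> nat) list \<Rightarrow> real" where
  "nudd_series N 0 w = 1 / fact (length w)"
| "nudd_series N (Suc l) w = udd_product (N (Suc l)) (letter_count (Suc l)) (nudd_series N l) (N (Suc l) + 1) w"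

text \<open>This is exp x * exp (- x) = 1; coefficientwise, (1 - 1)^n = 0 for n > 0.\<close>

lemma exp_antipode:
  defines "g \<equiv> \<lambda>w :: 'a list. 1 / fact (length w)"
  shows "g \<star> antipode g = unit_series"
proof
  fix w :: "'a list"
  let ?n = "length w"
  have "(\<Sum>i\<le>?n. g (take i w) * antipode g (drop i w)) = (\<Sum>i\<le>?n. 1 / fact ?n * (of_nat (?n choose i) * 1 ^ i * (-1) ^ (?n - i)))"
    by (rule sum.cong) (auto simp: g_def antipode_def binomial_fact)
  also have "\<dots> = 1 / fact ?n * (1 + (-1)) ^ ?n"
    by (simp only: binomial_ring sum_distrib_left)
  finally show "(g \<star> antipode g) w = unit_series w"
    by (simp add: conv_def unit_series_def power_0_left)
qed

text \<open>What allows stacking layers: the product over one layer meets the assumptions for the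
  next, its reversal weight growing as in \<open>X_rev\<close>.\<close>

lemma udd_layer_nudd_series:
  "udd_layer (letter_count (Suc l)) (odd_weight N l) (nudd_series N l)"
proof (induction l)
  case 0
  show ?case
  proof
    have "nudd_series N 0 = (\<lambda>w. 1 / fact (length w))" by auto
    then show "nudd_series N 0 \<star> antipode (nudd_series N 0) = unit_series"
      by (simp only: exp_antipode)
  qed (simp_all add: letter_count_append odd_weight_append odd_weight_def)
next
  case (Suc l)
  interpret udd_layer "N (Suc l)" "letter_count (Suc l)" "odd_weight N l" "nudd_series N l"
    by (rule Suc)
  have g: "nudd_series N (Suc l) = udd_product (N (Suc l)) (letter_count (Suc l)) (nudd_series N l) (N (Suc l) + 1)"
    by auto
  show ?case
    unfolding g
  proof
    fix w
    have "odd_weight N (Suc l) w = odd_weight N l w + N (Suc l) * letter_count (Suc l) w"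
      by (simp add: odd_weight_def)
    then show "X (N (Suc l) + 1) (rev w) = (-1) ^ odd_weight N (Suc l) w * X (N (Suc l) + 1) w"
      by (simp only: X_rev)
  qed (simp_all only: letter_count_append odd_weight_append X_antipode X_Nil)
qed

theorem nudd_series_vanishes:
  assumes "\<And>k. k \<in> {1..l} \<Longrightarrow> 1 \<le> N k"
  shows "vanishes_below (\<lambda>w. layer_order N (word_type w) l) (nudd_series N l)"
  using assms
proof (induction l)
  case 0
  show ?case by (simp add: vanishes_below_def)
next
  case (Suc l)
  let ?M = "N (Suc l)"
  let ?K = "\<lambda>w. layer_order N (word_type w) l"
  interpret udd_layer "N (Suc l)" "letter_count (Suc l)" "odd_weight N l" "nudd_series N l"
    by (rule udd_layer_nudd_series)
  have less: "word_type w i < 2" for w i by (simp add: word_type_def)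
  have g: "vanishes_below ?K (nudd_series N l)" using Suc by auto
  have K: "?K (u @ v) \<le> ?K u + ?K v" for u v
    unfolding word_type_append using Suc.prems less by (intro layer_order_subadditive) auto
  have "X (?M + 1) w = 0" if w: "w \<noteq> []" "length w \<le> layer_order N (word_type w) (Suc l)" for w
  proof -
    let ?r = "word_type w (Suc l)" and ?p = "parity_xor N (word_type w) 1 l"
    have "?r = 0 \<or> ?r = 1" "?p = 0 \<or> ?p = 1" "?M mod 2 = 0 \<or> ?M mod 2 = 1"
      using less[of w "Suc l"] parity_xor_less[of N "word_type w" 1 l] by auto
    moreover have "length w \<le> ?K w + ?r * (?M mod 2) \<or> length w \<le> ?r * ((?p + 1) mod 2) * outer_order N (Suc l)"
      using w(2) by (simp only: layer_order.simps le_max_iff_disj)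
    moreover have "length w \<noteq> 0" using w(1) by simp
    ultimately consider "length w \<le> ?K w" | "length w = ?K w + 1" "?r = 1" "odd ?M"
      | "?r = 1" "?p = 0" "length w \<le> outer_order N (Suc l)"
      unfolding odd_iff_mod_2_eq_one by (elim disjE) (auto simp: le_Suc_eq)
    then show ?thesis
    proof cases
      case 1
      then show ?thesis
        using X_vanishes_below[OF K g, of "?M + 1"] w(1) unfolding vanishes_below_def by blast
    next
      case 2
      then show ?thesis
        by (intro X_bonus[OF K g w(1)]) (auto simp: word_type_def odd_iff_mod_2_eq_one)
    next
      case 3
      show ?thesis
      proof (rule X_eq_zero)
        show "length w \<le> ?M" using 3 outer_order_le[of N "Suc l"] by simp
        show "length w \<le> outer_order N (Suc l)" by (rule 3)
        show "even (odd_weight N l w)" using 3 odd_weight_parity[of N l w] by (simp add: even_iff_mod_2_eq_zero)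
        show "odd (letter_count (Suc l) w)" using 3 by (simp add: word_type_def odd_iff_mod_2_eq_one)
        fix u j assume u: "odd (odd_weight N l u)" "length u < outer_order N (Suc l)"
        then have p: "parity_xor N (word_type u) 1 l = 1"
          by (simp only: odd_iff_mod_2_eq_one odd_weight_parity)
        \<comment> \<open>The \<open>+ 1\<close> in \<open>outer_order\<close> enters here: words
          shorter than it are no longer than any odd inner order, and at such lengths words of odd
          weight already vanish by \<open>layer_order_ge_odd\<close>.\<close>
        have "outer_order N (Suc l) - 1 \<le> N k" if "k \<in> {1..l}" "odd (N k)" for k
          using outer_order_le_odd[of k "Suc l" N] that by simp
        then have "outer_order N (Suc l) - 1 \<le> ?K u"
          using p less by (intro layer_order_ge_odd) auto
        then have "length u \<le> ?K u" using u by simp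
        moreover have "u \<noteq> []" using u by (auto simp: odd_weight_def letter_count_def)
        ultimately show "X j u = 0"
          using X_vanishes_below[OF K g, of j] unfolding vanishes_below_def by blast
      qed
    qed
  qed
  then show ?case by (simp add: vanishes_below_def)
qed

subsection \<open>Iterated integrals\<close>

text \<open>Words list their letters from the latest time to the earliest.\<close>

fun iterated :: "('a \<Rightarrow> real \<Rightarrow> real) \<Rightarrow> real \<Rightarrow> 'a list \<Rightarrow> real \<Rightarrow> real" where
  "iterated c a [] t = 1"
| "iterated c a (x # w) t = integral {a..t} (\<lambda>u. c x u * iterated c a w u)"

definition bounded_integrable :: "('a \<Rightarrow> real \<Rightarrow> real) \<Rightarrow> bool"
  where "bounded_integrable c \<longleftrightarrow> (\<forall>x u. \<bar>c x u\<bar> \<le> 1) \<and> (\<forall>x a b. c x integrable_on {a..b})"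

lemma integrable_mult_continuous:
  assumes "bounded_integrable c" "continuous_on {a..b} h"
  shows "(\<lambda>u. c x u * h u) integrable_on {a..b}"
proof -
  have "c x absolutely_integrable_on {a..b}"
    by (rule absolutely_integrable_integrable_bound[of _ _ "\<lambda>_. 1"])
       (use assms(1) in \<open>auto simp: bounded_integrable_def\<close>)
  moreover have "bounded (h ` {a..b})"
    using assms(2) by (intro compact_imp_bounded compact_continuous_image) auto
  moreover have "h \<in> borel_measurable (lebesgue_on {a..b})"
    by (rule continuous_imp_measurable_on_sets_lebesgue[OF assms(2)]) simp
  ultimately have "(\<lambda>u. h u * c x u) absolutely_integrable_on {a..b}"
    by (intro absolutely_integrable_bounded_measurable_product_real) auto
  then show ?thesis by (simp add: mult.commute set_lebesgue_integral_eq_integral(1))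
qed

lemma iterated_continuous:
  assumes "bounded_integrable c" shows "continuous_on {a..b} (iterated c a w)"
proof (induction w)
  case Nil
  have "iterated c a [] = (\<lambda>_. 1)" by auto
  then show ?case by simp
next
  case (Cons x w)
  have "iterated c a (x # w) = (\<lambda>t. integral {a..t} (\<lambda>u. c x u * iterated c a w u))" by auto
  then show ?case
    using indefinite_integral_continuous_1[OF integrable_mult_continuous[OF assms Cons]] by simp
qed

text \<open>Chen's identity.\<close>

lemma iterated_split:
  assumes c: "bounded_integrable c" and "a \<le> b" "b \<le> t"
  shows "iterated c a w t = ((\<lambda>w. iterated c b w t) \<star> (\<lambda>w. iterated c a w b)) w"
  using assms(3)
proof (induction w arbitrary: t)
  case Nil
  show ?case by simp
next
  case (Cons x w)
  have int: "(\<lambda>u. c x u * iterated c p w u) integrable_on {p..q}" for p q w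
    using c by (intro integrable_mult_continuous iterated_continuous)
  have "iterated c a (x # w) t
      = iterated c a (x # w) b + integral {b..t} (\<lambda>u. c x u * iterated c a w u)"
    using Henstock_Kurzweil_Integration.integral_combine[OF \<open>a \<le> b\<close> Cons.prems int] by simp
  also have "integral {b..t} (\<lambda>u. c x u * iterated c a w u)
      = integral {b..t} (\<lambda>u. \<Sum>i\<le>length w. c x u * iterated c b (take i w) u * iterated c a (drop i w) b)"
    by (rule integral_cong) (simp add: Cons.IH conv_def sum_distrib_left mult.assoc)
  also have "\<dots> = (\<Sum>i\<le>length w. integral {b..t} (\<lambda>u. c x u * iterated c b (take i w) u * iterated c a (drop i w) b))"
    by (intro integral_sum) (auto intro!: int integrable_on_mult_left)
  also have "\<dots> = ((\<lambda>w. iterated c b (x # w) t) \<star> (\<lambda>w. iterated c a w b)) w"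
    by (simp add: conv_def)
  finally show ?case by (simp add: conv_Cons)
qed

lemma integral_rescale:
  fixes f :: "real \<Rightarrow> real"
  assumes "0 < s"
  shows "integral {a..a + s * v} (\<lambda>u. f ((u - a) / s)) = s * integral {0..v} f"
    and "f integrable_on {0..v} \<Longrightarrow> (\<lambda>u. f ((u - a) / s)) integrable_on {a..a + s * v}"
proof -
  have i: "((\<lambda>u. f ((u - a) / s)) has_integral s * I) {a..a + s * v} \<longleftrightarrow> (f has_integral I) {0..v}" for I
    using has_integral_affinity_iff[of "1 / s" f "- a / s" I 0 v] assms
    by (simp add: divide_inverse algebra_simps)
  show "(\<lambda>u. f ((u - a) / s)) integrable_on {a..a + s * v}" if "f integrable_on {0..v}"
    using that i by (auto simp: integrable_on_def)
  show "integral {a..a + s * v} (\<lambda>u. f ((u - a) / s)) = s * integral {0..v} f"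
  proof (cases "f integrable_on {0..v}")
    case True
    then show ?thesis using i by (metis has_integral_integral integral_unique)
  next
    case False
    \<comment> \<open>Neither side is integrable, so both integrals take the default value
      0.\<close>
    then have "\<not> (\<lambda>u. f ((u - a) / s)) integrable_on {a..a + s * v}"
      using i[of "_ / s"] assms by (auto simp: integrable_on_def)
    then show ?thesis using False by (simp add: not_integrable_integral)
  qed
qed

text \<open>Each letter gives one substitution u = a + s v, hence a factor \<open>s\<close>. The
  relation of \<open>c\<close> to \<open>c'\<close> is assumed on a half-open interval, matching the
  cells; the right end is a null set.\<close>

lemma iterated_rescale:
  assumes s: "0 < s" and c: "\<And>x u. a \<le> u \<Longrightarrow> u < a + s \<Longrightarrow> c x u = \<epsilon> x * c' x ((u - a) / s)"
    and t: "a \<le> t" "t \<le> a + s"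
  shows "iterated c a w t = s ^ length w * (\<Prod>x\<leftarrow>w. \<epsilon> x) * iterated c' 0 w ((t - a) / s)"
  using t
proof (induction w arbitrary: t)
  case (Cons x w)
  let ?k = "s ^ length w * (\<Prod>x\<leftarrow>w. \<epsilon> x)"
  have "iterated c a (x # w) t
      = integral {a..t} (\<lambda>u. ?k * \<epsilon> x * (\<lambda>v. c' x v * iterated c' 0 w v) ((u - a) / s))"
    unfolding iterated.simps
  proof (rule integral_spike[of "{a + s}"])
    fix u assume u: "u \<in> {a..t} - {a + s}"
    then have "c x u = \<epsilon> x * c' x ((u - a) / s)" using Cons.prems by (intro c) auto
    moreover have "iterated c a w u = ?k * iterated c' 0 w ((u - a) / s)"
      using Cons.IH[of u] Cons.prems u by auto
    ultimately show "?k * \<epsilon> x * (\<lambda>v. c' x v * iterated c' 0 w v) ((u - a) / s) = c x u * iterated c a w u"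
      by simp
  qed simp
  also have "\<dots> = ?k * \<epsilon> x * integral {a..t} (\<lambda>u. (\<lambda>v. c' x v * iterated c' 0 w v) ((u - a) / s))"
    by (rule integral_mult_right)
  also have "{a..t} = {a..a + s * ((t - a) / s)}" using s by simp
  also have "?k * \<epsilon> x * integral \<dots> (\<lambda>u. (\<lambda>v. c' x v * iterated c' 0 w v) ((u - a) / s))
      = ?k * \<epsilon> x * (s * integral {0..(t - a) / s} (\<lambda>v. c' x v * iterated c' 0 w v))"
    by (simp only: integral_rescale(1)[OF s, where f = "\<lambda>v. c' x v * iterated c' 0 w v"])
  finally show ?case by (simp add: mult_ac)
qed simp

text \<open>Set to 0 outside [0, 1), where \<open>modulation\<close> has no specified value, so that
  it is bounded and integrable on every interval.\<close>

definition letter_function :: "nat \<Rightarrow> (nat \<Rightarrow> nat) \<Rightarrow> (nat \<Rightarrow> nat) \<Rightarrow> real \<Rightarrow> real"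
  where "letter_function l N x u =
    (if 0 \<le> u \<and> u < 1 then \<Prod>i=1..l. modulation l N i u ^ x i else 0)"

lemma letter_function_0: "letter_function 0 N x u = (if 0 \<le> u \<and> u < 1 then 1 else 0)"
  by (simp add: letter_function_def)

section \<open>Self-similarity of the timings under an added outer layer\<close>

definition udd_time :: "nat \<Rightarrow> nat \<Rightarrow> real"
  where "udd_time M m = (sin (real m * pi / (2 * (real M + 1))))\<^sup>2"

lemma udd_time_0 [simp]: "udd_time M 0 = 0"
  by (simp add: udd_time_def)

lemma udd_time_last: "udd_time M (M + 1) = 1"
proof -
  have "real (M + 1) * pi / (2 * (real M + 1)) = pi / 2" by (simp add: field_simps)
  then show ?thesis by (simp only: udd_time_def sin_pi_half) simp
qed

lemma udd_time_Suc: "udd_time M (Suc m) = udd_time M m + udd_interval M (Suc m)"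
  using udd_interval_eq[of "Suc m" M] by (simp only: udd_time_def) simp

lemma udd_length_eq: "udd_length M (int m) = udd_interval M m"
  by (simp add: udd_length_def udd_interval_def)

lemma udd_time_bounds: "0 \<le> udd_time M m" "udd_time M m \<le> 1"
  by (simp_all add: udd_time_def abs_square_le_1)

lemma nudd_time_outermost: "nudd_time l N j l = udd_time (N l) (j l)"
  by (simp add: nudd_time.simps[of l N j l] udd_time_def)

text \<open>An added outermost layer places an affine copy of the inner scheme in each of its
  intervals; the induction goes inwards from layer \<open>l\<close>, following the recursion of
  \<open>nudd_time\<close>.\<close>

lemma nudd_time_Suc_layer:
  assumes "i \<le> l"
  shows "nudd_time (Suc l) N j i
    = udd_time (N (Suc l)) (j (Suc l) - 1) + udd_interval (N (Suc l)) (j (Suc l)) * nudd_time l N j i"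
  using assms
proof (induction "l - i" arbitrary: i j)
  case 0
  then have "i = l" by simp
  show ?case
    unfolding \<open>i = l\<close> nudd_time.simps[of "Suc l" N j l]
    by (simp add: nudd_time_outermost) (simp add: udd_time_def)
next
  case (Suc d)
  then have "i < l" by simp
  let ?j = "j(i + 1 := j (i + 1) - 1)"
  have "nudd_time (Suc l) N ?j (i + 1)
      = udd_time (N (Suc l)) (?j (Suc l) - 1) + udd_interval (N (Suc l)) (?j (Suc l)) * nudd_time l N ?j (i + 1)"
    by (rule Suc.hyps(1)) (use Suc \<open>i < l\<close> in auto)
  then show ?case
    using \<open>i < l\<close> by (simp add: nudd_time.simps[of _ _ _ i] algebra_simps)
qed

text \<open>Extending the inner index tuple by the outermost index \<open>Suc m\<close> sends cells
  to cells, so signs can be read off by \<open>modulation_eq\<close>. Counting \<open>m\<close> from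
  0 gives the sign \<open>(-1) ^ m\<close>.\<close>

lemma modulation_Suc_layer:
  fixes N :: "nat \<Rightarrow> nat" and l :: nat
  defines "M \<equiv> N (Suc l)"
  assumes m: "m \<le> M" and u: "udd_time M m \<le> u" "u < udd_time M (Suc m)"
  shows "modulation (Suc l) N (Suc l) u = (-1) ^ m"
    and "i \<in> {1..l} \<Longrightarrow>
      modulation (Suc l) N i u = modulation l N i ((u - udd_time M m) / udd_interval M (Suc m))"
proof -
  let ?s = "udd_interval M (Suc m)" and ?a = "udd_time M m"
  have s: "0 < ?s" using m by (intro udd_interval_pos) auto
  have "modulation (Suc l) N (Suc l) u = (-1) ^ ((\<lambda>_. Suc m) (Suc l) - 1)"
    by (rule modulation_eq) (use m u in \<open>auto simp: M_def nudd_indices_def nudd_cell_def nudd_time.simps[of _ _ _ "Suc l"] udd_time_def\<close>)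
  then show "modulation (Suc l) N (Suc l) u = (-1) ^ m" by simp
  assume i: "i \<in> {1..l}"
  let ?v = "(u - ?a) / ?s"
  have v: "0 \<le> ?v" "?v < 1" using u s by (auto simp: udd_time_Suc divide_simps)
  obtain j where j: "j \<in> nudd_indices l N i" "?v \<in> nudd_cell l N i j"
    using nudd_cell_exists[OF _ v, of i l N] i by auto
  let ?j = "j(Suc l := Suc m)"
  have "i \<le> Suc l" using i by simp
  moreover have "?j \<in> nudd_indices (Suc l) N i" using j(1) m i by (auto simp: nudd_indices_def M_def)
  moreover have "u \<in> nudd_cell (Suc l) N i ?j"
  proof -
    have "nudd_time (Suc l) N (?j(i := ?j i - 1)) i = ?a + ?s * nudd_time l N (j(i := j i - 1)) i"
      using i nudd_time_cong[of i l "?j(i := ?j i - 1)" "j(i := j i - 1)" N]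
      by (auto simp: nudd_time_Suc_layer M_def)
    moreover have "nudd_time (Suc l) N ?j i = ?a + ?s * nudd_time l N j i"
      using i nudd_time_cong[of i l ?j j N] by (auto simp: nudd_time_Suc_layer M_def)
    moreover have "nudd_time l N (j(i := j i - 1)) i \<le> ?v" "?v < nudd_time l N j i"
      using j(2) by (auto simp: nudd_cell_def)
    ultimately show ?thesis using s
      by (auto simp: nudd_cell_def pos_le_divide_eq pos_divide_less_eq mult.commute)
  qed
  ultimately have "modulation (Suc l) N i u = (-1) ^ (?j i - 1)"
    by (rule modulation_eq)
  also have "\<dots> = modulation l N i ?v"
    using modulation_eq[OF _ j] i by auto
  finally show "modulation (Suc l) N i u = modulation l N i ?v" .
qed

lemma letter_function_Suc_layer:
  fixes N :: "nat \<Rightarrow> nat" and l :: nat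
  defines "M \<equiv> N (Suc l)"
  assumes m: "m \<le> M" and u: "udd_time M m \<le> u" "u < udd_time M m + udd_interval M (Suc m)"
  shows "letter_function (Suc l) N x u
    = (-1) ^ (m * x (Suc l)) * letter_function l N x ((u - udd_time M m) / udd_interval M (Suc m))"
proof -
  let ?s = "udd_interval M (Suc m)" and ?a = "udd_time M m"
  have s: "0 < ?s" using m by (intro udd_interval_pos) auto
  have "0 \<le> u" "u < 1"
    using u udd_time_bounds[of M m] udd_time_bounds[of M "Suc m"] m by (auto simp: udd_time_Suc)
  moreover have "0 \<le> (u - ?a) / ?s" "(u - ?a) / ?s < 1" using u s by (auto simp: divide_simps)
  ultimately show ?thesis
    using modulation_Suc_layer[of m N l u] m u
    by (simp add: letter_function_def M_def udd_time_Suc power_mult)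
qed


text \<open>Integrability goes by induction on layers: on each outermost interval the function is,
  off the right end, a signed rescaled copy of the one with a layer less.\<close>

lemma bounded_integrable_letter_function: "bounded_integrable (letter_function l N)"
proof (induction l)
  case 0
  have "(\<lambda>u. if 0 \<le> u \<and> u < 1 then 1 else 0 :: real) integrable_on {a..b}" for a b :: real
  proof -
    have "(\<lambda>u. if u \<in> {0..1} then 1 else 0 :: real) integrable_on {a..b}"
      by (subst integrable_restrict_Int) (auto simp: Int_atLeastAtMost)
    then show ?thesis by (rule integrable_spike[of _ _ "{1}"]) auto
  qed
  then show ?case by (simp add: bounded_integrable_def letter_function_0[abs_def])
next
  case (Suc l)
  let ?M = "N (Suc l)"
  let ?f = "letter_function (Suc l) N"
  have "\<bar>?f x u\<bar> \<le> 1" for x u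
  proof (cases "0 \<le> u \<and> u < 1")
    case True
    have "\<bar>modulation (Suc l) N i u\<bar> = 1" if "i \<in> {1..Suc l}" for i
      using nudd_cell_exists[of i "Suc l" u N] modulation_eq[of i "Suc l" _ N u] True that
      by (auto simp: power_abs)
    then have "(\<Prod>i=1..Suc l. \<bar>modulation (Suc l) N i u ^ x i\<bar>) = 1"
      by (intro prod.neutral) (simp add: power_abs)
    then have "\<bar>\<Prod>i=1..Suc l. modulation (Suc l) N i u ^ x i\<bar> = 1" by (simp only: abs_prod)
    then show ?thesis using True by (simp only: letter_function_def) simp
  next
    case False
    then have "?f x u = 0" unfolding letter_function_def by (rule if_not_P)
    then show ?thesis by simp
  qed
  moreover have "?f x integrable_on {a..b}" for x a b
  proof -
    have "?f x integrable_on {0..udd_time ?M m}" if "m \<le> ?M + 1" for m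
      using that
    proof (induction m)
      case (Suc m)
      let ?s = "udd_interval ?M (Suc m)" and ?a = "udd_time ?M m"
      have s: "0 < ?s" using Suc.prems by (intro udd_interval_pos) auto
      have "letter_function l N x integrable_on {0..1}"
        using \<open>bounded_integrable (letter_function l N)\<close> by (simp add: bounded_integrable_def)
      from integral_rescale(2)[OF s this, of ?a]
      have "(\<lambda>u. letter_function l N x ((u - ?a) / ?s)) integrable_on {?a..?a + ?s}" by simp
      then have "(\<lambda>u. (-1) ^ (m * x (Suc l)) * letter_function l N x ((u - ?a) / ?s)) integrable_on {?a..?a + ?s}"
        by (rule integrable_on_mult_right)
      then have "?f x integrable_on {?a..udd_time ?M (Suc m)}"
        unfolding udd_time_Suc
        by (rule integrable_spike[of _ _ "{?a + ?s}"]) (use Suc.prems in \<open>auto intro!: letter_function_Suc_layer\<close>)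
      moreover have "?f x integrable_on {0..?a}" using Suc by simp
      moreover have "0 \<le> ?a" "?a \<le> udd_time ?M (Suc m)"
        using s udd_time_bounds(1)[of ?M m] Suc.prems by (simp_all add: udd_time_Suc)
      ultimately show ?case using Henstock_Kurzweil_Integration.integrable_combine by blast
    qed (use integrable_on_refl[of "?f x" 0] in simp)
    from this[of "?M + 1"] have "?f x integrable_on {0..1}" by (simp only: udd_time_last order_refl)
    then have "(\<lambda>u. if u \<in> {0..1} then ?f x u else 0) integrable_on UNIV"
      by (simp only: integrable_restrict_UNIV)
    moreover have "(\<lambda>u. if u \<in> {0..1} then ?f x u else 0) = ?f x"
      by (auto simp: letter_function_def)
    ultimately have "?f x integrable_on UNIV" by metis
    then show ?thesis by (rule integrable_on_subinterval) simp
  qed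
  ultimately show ?case by (simp add: bounded_integrable_def)
qed

text \<open>Cutting at the outermost timings by Chen's identity gives one factor per interval, and
  rescaling turns each into \<open>udd_factor\<close>.\<close>

theorem iterated_letter_function: "iterated (letter_function l N) 0 w 1 = nudd_series N l w"
proof (induction l arbitrary: w)
  case 0
  have "iterated (letter_function 0 N) 0 w t = t ^ length w / fact (length w)" if "0 \<le> t" "t \<le> 1" for t
    using that
  proof (induction w arbitrary: t)
    case (Cons x w)
    have "iterated (letter_function 0 N) 0 (x # w) t
        = integral {0..t} (\<lambda>u. u ^ length w / fact (length w))"
      unfolding iterated.simps
    proof (rule integral_spike[of "{1}"])
      fix u assume "u \<in> {0..t} - {1}"
      then have "letter_function 0 N x u = 1" "iterated (letter_function 0 N) 0 w u = u ^ length w / fact (length w)"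
        using Cons.prems by (simp add: letter_function_0, intro Cons.IH) auto
      then show "u ^ length w / fact (length w) = letter_function 0 N x u * iterated (letter_function 0 N) 0 w u"
        by simp
    qed simp
    also have "((\<lambda>u. u ^ length w / fact (length w)) has_integral
        t ^ Suc (length w) / fact (Suc (length w)) - 0 ^ Suc (length w) / fact (Suc (length w))) {0..t}"
    proof (rule fundamental_theorem_of_calculus)
      fix u
      let ?n = "length w"
      have "((\<lambda>u. u ^ Suc ?n / fact (Suc ?n)) has_real_derivative real (Suc ?n) * u ^ ?n / fact (Suc ?n)) (at u within {0..t})"
        by (auto intro!: derivative_eq_intros simp del: of_nat_Suc fact_Suc power_Suc)
      then show "((\<lambda>u. u ^ Suc ?n / fact (Suc ?n)) has_vector_derivative u ^ ?n / fact ?n) (at u within {0..t})"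
        by (simp add: has_real_derivative_iff_has_vector_derivative del: of_nat_Suc)
    qed (use Cons.prems in simp)
    then have "integral {0..t} (\<lambda>u. u ^ length w / fact (length w)) = t ^ Suc (length w) / fact (Suc (length w))"
      by (subst integral_unique) auto
    finally show ?case by simp
  qed simp
  then show ?case by simp
next
  case (Suc l)
  let ?M = "N (Suc l)" and ?f = "letter_function (Suc l) N"
  let ?X = "udd_product ?M (letter_count (Suc l)) (nudd_series N l)"
  have "iterated ?f 0 w (udd_time ?M m) = ?X m w" if "m \<le> ?M + 1" for m w
    using that
  proof (induction m arbitrary: w)
    case 0
    show ?case by (cases w) (simp_all add: unit_series_def)
  next
    case (Suc m)
    let ?s = "udd_interval ?M (Suc m)" and ?a = "udd_time ?M m"
    have s: "0 < ?s" using Suc.prems by (intro udd_interval_pos) auto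
    have "iterated ?f ?a w (?a + ?s) = udd_factor ?M (letter_count (Suc l)) (nudd_series N l) (int (Suc m)) w" for w
    proof -
      have "iterated ?f ?a w (?a + ?s) = ?s ^ length w * (\<Prod>x\<leftarrow>w. (-1) ^ (m * x (Suc l)))
          * iterated (letter_function l N) 0 w ((?a + ?s - ?a) / ?s)"
        by (rule iterated_rescale[OF s]) (use s Suc.prems in \<open>auto intro!: letter_function_Suc_layer\<close>)
      moreover have "(\<Prod>x\<leftarrow>w. (-1) ^ (m * x (Suc l))) = alt_sign (int (Suc m)) ^ letter_count (Suc l) w"
      proof -
        have "alt_sign (int (Suc m)) = (-1) ^ m" by (simp add: alt_sign_def)
        then show ?thesis by (induction w) (simp_all add: letter_count_def power_add power_mult)
      qed
      ultimately show ?thesis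
        using s by (simp add: udd_factor_def udd_length_eq \<open>\<And>w. iterated (letter_function l N) 0 w 1 = _\<close> del: of_nat_Suc)
    qed
    then have "(\<lambda>w. iterated ?f ?a w (?a + ?s)) = udd_factor ?M (letter_count (Suc l)) (nudd_series N l) (int (Suc m))"
      by (rule ext)
    moreover have "(\<lambda>w. iterated ?f 0 w ?a) = ?X m" using Suc by auto
    moreover have "iterated ?f 0 w (?a + ?s) = ((\<lambda>w. iterated ?f ?a w (?a + ?s)) \<star> (\<lambda>w. iterated ?f 0 w ?a)) w"
      using s udd_time_bounds[of ?M m] Suc.prems
      by (intro iterated_split bounded_integrable_letter_function) auto
    ultimately show ?case by (simp only: udd_time_Suc udd_product.simps)
  qed
  from this[of "?M + 1" w] show ?case by (simp only: udd_time_last nudd_series.simps)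
qed

text \<open>Coordinates beyond \<open>k\<close> are fixed during the inner integrations, so their
  factors come out. Reversing the list puts the latest time first, and the endpoint 1, where
  \<open>h\<close> and \<open>c\<close> may differ, is a null set.\<close>

lemma ordered_integral_prod:
  assumes h: "\<And>p u. 0 \<le> u \<Longrightarrow> u < 1 \<Longrightarrow> h p u = c (R p) u" and "k \<le> n" "t \<le> 1"
  shows "ordered_integral k (\<lambda>\<eta>. \<Prod>p=1..n. h p (\<eta> p)) x t
    = (\<Prod>p=k+1..n. h p (x p)) * iterated c 0 (map R (rev [1..<k+1])) t"
  using assms(2,3)
proof (induction k arbitrary: x t)
  case (Suc k)
  let ?w = "map R (rev [1..<k+1])"
  let ?P = "\<Prod>p=Suc k+1..n. h p (x p)"
  have "ordered_integral (Suc k) (\<lambda>\<eta>. \<Prod>p=1..n. h p (\<eta> p)) x t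
      = integral {0..t} (\<lambda>u. ?P * (c (R (Suc k)) u * iterated c 0 ?w u))"
    unfolding ordered_integral.simps
  proof (rule integral_spike[of "{1}"])
    fix u assume u: "u \<in> {0..t} - {1}"
    then have "u \<le> 1" "0 \<le> u" "u < 1" using Suc.prems by auto
    have "(\<Prod>p=k+1..n. h p ((x(Suc k := u)) p)) = h (Suc k) u * (\<Prod>p=Suc k+1..n. h p ((x(Suc k := u)) p))"
      using Suc.prems by (simp add: prod.atLeast_Suc_atMost)
    also have "(\<Prod>p=Suc k+1..n. h p ((x(Suc k := u)) p)) = ?P" by (rule prod.cong) auto
    finally show "?P * (c (R (Suc k)) u * iterated c 0 ?w u)
        = ordered_integral k (\<lambda>\<eta>. \<Prod>p=1..n. h p (\<eta> p)) (x(Suc k := u)) u"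
      using Suc.IH[of u "x(Suc k := u)"] Suc.prems h[of u "Suc k"] \<open>u \<le> 1\<close> \<open>0 \<le> u\<close> \<open>u < 1\<close>
      by (simp add: mult_ac del: upt_Suc fun_upd_apply One_nat_def)
  qed simp
  also have "\<dots> = ?P * iterated c 0 (R (Suc k) # ?w) t" by simp
  finally show ?case by simp
qed simp

theorem nudd_coefficient_eq: "nudd_coefficient l N n R = nudd_series N l (map R (rev [1..<n+1]))"
  unfolding nudd_coefficient_def
  by (subst ordered_integral_prod[where c = "letter_function l N" and R = R])
     (auto simp: letter_function_def iterated_letter_function)

theorem mainTheorem1:
  fixes l :: nat and N r :: "nat \<Rightarrow> nat"
  assumes "1 \<le> l"
    and "\<forall>i\<in>{1..l}. 1 \<le> N i"
    and "r \<in> {1..l} \<rightarrow> {0, 1}"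
  shows "eliminates_errors l N r (decoupling_order l N r)"
  unfolding eliminates_errors_def
proof (intro allI impI)
  fix n R
  assume n: "1 \<le> n" "n \<le> decoupling_order l N r"
    and R: "\<forall>i\<in>{1..l}. (\<Sum>p=1..n. R p i) mod 2 = r i"
  let ?w = "map R (rev [1..<n+1])"
  have "word_type ?w i = r i" if "i \<in> {1..l}" for i
  proof -
    have "letter_count i ?w = (\<Sum>p=1..n. R p i)"
      by (simp add: letter_count_def comp_def rev_map[symmetric] sum_list_rev interv_sum_list_conv_sum_set_nat
          atLeastLessThanSuc_atLeastAtMost del: upt_Suc sum.op_ivl_Suc)
    then show ?thesis using R that by (simp add: word_type_def)
  qed
  then have "layer_order N (word_type ?w) l = layer_order N r l"
    by (rule layer_order_cong)
  then have "length ?w \<le> layer_order N (word_type ?w) l"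
    using n decoupling_order_le[OF assms(1), of N r] by simp
  moreover have "?w \<noteq> []" using n by simp
  ultimately have "nudd_series N l ?w = 0"
    using nudd_series_vanishes[of l N] assms(2) unfolding vanishes_below_def by blast
  then show "nudd_coefficient l N n R = 0" by (simp only: nudd_coefficient_eq)
qed

end
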